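(* Let $\psi$ be an entire function that is not identically zero, and let $\varphi(z)=az+b$ with $a,b\in\mathbb{C}$, $|a|<1$. Suppose that $C_{\psi,\varphi}$ is bounded on $\mathcal{F}^2$ and that every $\lambda$ in the essential spectrum $\sigma_e(C_{\psi,\varphi})$ satisfies $|\lambda|\le\left|\psi\!\left(\frac{b}{1-a}\right)\right|$. Then $C_{\psi,\varphi}$ is normaloid if and only if $\psi=\psi(0)K_{b\frac{\bar a-1}{a-1}}$, i.e. $\psi(z)=\psi(0)\exp\!\left(\bar b\,\frac{a-1}{\bar a-1}\,z\right)$.
   Context: $\mathcal{F}^2$ is the Fock space: the Hilbert space of entire functions $f$ on $\mathbb{C}$ with $\int_{\mathbb{C}}|f(z)|^2\,d\mu(z)<\infty$, where $d\mu(z)=\pi^{-1}e^{-|z|^2}\,dA(z)$, with inner product $\langle f,g\rangle=\int f\overline{g}\,d\mu$. Its reproducing kernel at $w$ is $K_w(z)=e^{\bar w z}$. The weighted composition operator is $C_{\psi,\varphi}f=\psi\cdot(f\circ\varphi)$. A bounded operator $T$ is normaloid if $\|T\|=r(T)$, the spectral radius. *)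

theory Defs
  imports "HOL-Analysis.Analysis"
begin

definition fock_weight :: "complex \<Rightarrow> real" where
  "fock_weight z = exp (- (cmod z)\<^sup>2) / pi"

definition F2 :: "(complex \<Rightarrow> complex) set" where
  "F2 = {f. f holomorphic_on UNIV \<and>
            (\<lambda>z. (cmod (f z))\<^sup>2 * fock_weight z) integrable_on UNIV}"

definition fock_norm :: "(complex \<Rightarrow> complex) \<Rightarrow> real" where
  "fock_norm f = sqrt (integral UNIV (\<lambda>z. (cmod (f z))\<^sup>2 * fock_weight z))"

definition wcomp :: "(complex \<Rightarrow> complex) \<Rightarrow> (complex \<Rightarrow> complex)
     \<Rightarrow> (complex \<Rightarrow> complex) \<Rightarrow> (complex \<Rightarrow> complex)" where
  "wcomp \<psi> \<phi> f = (\<lambda>z. \<psi> z * f (\<phi> z))"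

definition bounded_op :: "((complex \<Rightarrow> complex) \<Rightarrow> (complex \<Rightarrow> complex)) \<Rightarrow> bool" where
  "bounded_op T \<longleftrightarrow>
     (\<forall>f\<in>F2. \<forall>g\<in>F2. \<forall>c d. T (\<lambda>z. c * f z + d * g z) = (\<lambda>z. c * T f z + d * T g z)) \<and>
     (\<forall>f\<in>F2. T f \<in> F2) \<and>
     (\<exists>C. \<forall>f\<in>F2. fock_norm (T f) \<le> C * fock_norm f)"

definition op_norm :: "((complex \<Rightarrow> complex) \<Rightarrow> (complex \<Rightarrow> complex)) \<Rightarrow> real" where
  "op_norm T = Sup {fock_norm (T f) | f. f \<in> F2 \<and> fock_norm f \<le> 1}"

definition shift_op :: "((complex \<Rightarrow> complex) \<Rightarrow> (complex \<Rightarrow> complex)) \<Rightarrow> complex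
     \<Rightarrow> (complex \<Rightarrow> complex) \<Rightarrow> (complex \<Rightarrow> complex)" where
  "shift_op T l f = (\<lambda>z. T f z - l * f z)"

text \<open>Spectrum: lambda such that T - lambda I is not invertible on F^2
  (for bounded operators, bijectivity gives a bounded inverse).\<close>
definition fock_spectrum :: "((complex \<Rightarrow> complex) \<Rightarrow> (complex \<Rightarrow> complex)) \<Rightarrow> complex set" where
  "fock_spectrum T = {l. \<not> bij_betw (shift_op T l) F2 F2}"

definition spectral_radius :: "((complex \<Rightarrow> complex) \<Rightarrow> (complex \<Rightarrow> complex)) \<Rightarrow> real" where
  "spectral_radius T = Sup (cmod ` fock_spectrum T)"

definition normaloid :: "((complex \<Rightarrow> complex) \<Rightarrow> (complex \<Rightarrow> complex)) \<Rightarrow> bool" where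
  "normaloid T \<longleftrightarrow> op_norm T = spectral_radius T"

definition fin_spanned :: "(complex \<Rightarrow> complex) set \<Rightarrow> bool" where
  "fin_spanned K \<longleftrightarrow> (\<exists>B. finite B \<and> B \<subseteq> F2 \<and>
      (\<forall>f\<in>K. \<exists>c. f = (\<lambda>z. \<Sum>b\<in>B. c b * b z)))"

definition fin_codim :: "(complex \<Rightarrow> complex) set \<Rightarrow> bool" where
  "fin_codim R \<longleftrightarrow> (\<exists>B. finite B \<and> B \<subseteq> F2 \<and>
      (\<forall>f\<in>F2. \<exists>g\<in>R. \<exists>c. f = (\<lambda>z. g z + (\<Sum>b\<in>B. c b * b z))))"

definition closed_in_F2 :: "(complex \<Rightarrow> complex) set \<Rightarrow> bool" where
  "closed_in_F2 R \<longleftrightarrow> (\<forall>g f. (\<forall>n. g n \<in> R) \<and> f \<in> F2 \<and>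
      (\<lambda>n. fock_norm (\<lambda>z. g n z - f z)) \<longlonglongrightarrow> 0 \<longrightarrow> f \<in> R)"

definition fredholm :: "((complex \<Rightarrow> complex) \<Rightarrow> (complex \<Rightarrow> complex)) \<Rightarrow> bool" where
  "fredholm S \<longleftrightarrow> fin_spanned {f\<in>F2. S f = (\<lambda>z. 0)} \<and>
     closed_in_F2 (S ` F2) \<and> fin_codim (S ` F2)"

definition ess_spectrum :: "((complex \<Rightarrow> complex) \<Rightarrow> (complex \<Rightarrow> complex)) \<Rightarrow> complex set" where
  "ess_spectrum T = {l. \<not> fredholm (shift_op T l)}"

end

theory Submission
  imports Defs "HOL-Complex_Analysis.Complex_Analysis"
begin

text \<open>
  Let \<open>p = b / (1 - a)\<close> be the fixed point of \<open>z \<mapsto> a z + b\<close>, and let \<open>T\<close> be the operator.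
  Functions in the range of \<open>T - \<psi> p\<close> vanish at \<open>p\<close>, so \<open>\<psi> p\<close> lies in the spectrum.
  For \<open>\<bar>\<lambda>\<bar> > \<bar>\<psi> p\<bar>\<close> the operator \<open>T - \<lambda>\<close> is injective, because an eigenfunction vanishes near the
  attracting point \<open>p\<close> by the maximum of its modulus on a small disc, and it has closed range by the
  hypothesis on the essential spectrum; hence it is bounded below. On the connected set
  \<open>{\<lambda>. \<bar>\<lambda>\<bar> > \<bar>\<psi> p\<bar>}\<close> surjectivity is then an open and closed condition that holds for large \<open>\<lambda>\<close>.
  So the spectral radius is \<open>\<bar>\<psi> p\<bar>\<close>, and normaloid means \<open>\<parallel>T\<parallel> = \<bar>\<psi> p\<bar>\<close>.

  Move \<open>p\<close> to the origin by a Weyl operator. Since \<open>(T K\<^sub>p) p = \<psi> p * K\<^sub>p p\<close>,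
  equality of the norms forces \<open>T K\<^sub>p = \<psi> p * K\<^sub>p\<close> by the equality case of the mean value
  inequality, and this determines \<open>\<psi>\<close>. Conversely, for this \<open>\<psi>\<close> the operator is conjugate to
  \<open>\<psi> p\<close> times the dilation \<open>h \<mapsto> h (a z)\<close>, which is a contraction.
\<close>

section \<open>Operators that are bounded below\<close>

lemma approx_imp_bounded_below:
  fixes f :: "'a::banach \<Rightarrow> 'b::real_normed_vector"
  assumes lin: "bounded_linear f" and "inj f" and "K > 0"
    and approx: "\<And>v. v \<in> range f \<Longrightarrow> \<exists>x. norm x \<le> K * norm v \<and> norm (v - f x) \<le> norm v / 2"
  shows "norm x \<le> 2 * K * norm (f x)"
proof -
  interpret f: bounded_linear f by fact
  obtain g where g: "\<And>v. v \<in> range f \<Longrightarrow> norm (g v) \<le> K * norm v \<and> norm (v - f (g v)) \<le> norm v / 2"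
    using approx by metis
  define v where "v n = ((\<lambda>u. u - f (g u)) ^^ n) (f x)" for n
  have v0: "v 0 = f x" and vS: "v (Suc n) = v n - f (g (v n))" for n
    by (simp_all add: v_def)
  have vR: "v n \<in> range f" for n
  proof (induction n)
    case (Suc n)
    then obtain y where "v n = f y" by auto
    then show ?case by (auto simp: vS f.diff[symmetric])
  qed (simp add: v0)
  have vn: "norm (v n) \<le> norm (f x) * (1/2)^n" for n
  proof (induction n)
    case (Suc n)
    have "norm (v (Suc n)) \<le> norm (v n) / 2" using g[OF vR] by (simp add: vS)
    with Suc show ?case by simp
  qed (simp add: v0)
  have gn: "norm (g (v n)) \<le> K * norm (f x) * (1/2)^n" for n
  proof -
    have "norm (g (v n)) \<le> K * norm (v n)" using g[OF vR] by simp
    also have "\<dots> \<le> K * (norm (f x) * (1/2)^n)" using vn \<open>K > 0\<close> by (intro mult_left_mono) auto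
    finally show ?thesis by simp
  qed
  have geo: "(\<lambda>n. K * norm (f x) * (1/2)^n) sums (K * norm (f x) * 2)"
    using sums_mult[OF geometric_sums[of "1/2::real"]] by simp
  have sn: "summable (\<lambda>n. norm (g (v n)))"
    by (rule summable_comparison_test'[OF sums_summable[OF geo], of 0]) (use gn in simp)
  then have s: "summable (\<lambda>n. g (v n))" by (rule summable_norm_cancel)
  have "f (\<Sum>i<n. g (v i)) = f x - v n" for n
    by (induction n) (simp_all add: v0 vS f.add f.zero)
  moreover have "v \<longlonglongrightarrow> 0"
  proof (rule Lim_null_comparison)
    show "\<forall>\<^sub>F n in sequentially. norm (v n) \<le> norm (f x) * (1/2)^n" using vn by simp
    show "(\<lambda>n. norm (f x) * (1/2)^n) \<longlonglongrightarrow> 0" 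
      by (rule tendsto_mult_right_zero) (simp add: LIMSEQ_power_zero)
  qed
  ultimately have "(\<lambda>n. f (\<Sum>i<n. g (v i))) \<longlonglongrightarrow> f x"
    using tendsto_diff[OF tendsto_const[of "f x"]] by fastforce
  moreover have "(\<lambda>n. f (\<Sum>i<n. g (v i))) \<longlonglongrightarrow> f (\<Sum>n. g (v n))"
    by (intro f.tendsto summable_LIMSEQ s)
  ultimately have "f x = f (\<Sum>n. g (v n))" by (rule LIMSEQ_unique)
  then have "x = (\<Sum>n. g (v n))" using \<open>inj f\<close> by (simp add: inj_eq)
  also have "norm \<dots> \<le> (\<Sum>n. norm (g (v n)))" by (rule summable_norm[OF sn])
  also have "\<dots> \<le> (\<Sum>n. K * norm (f x) * (1/2)^n)"
    by (intro suminf_le gn sn sums_summable[OF geo])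
  also have "\<dots> = 2 * K * norm (f x)" using sums_unique[OF geo] by simp
  finally show ?thesis .
qed

lemma Baire_closed_cover:
  fixes R :: "'b::banach set"
  assumes "closed R" "R \<noteq> {}" and cover: "R \<subseteq> (\<Union>n::nat. A n)" and clo: "\<And>n. closed (A n)"
  obtains n y e where "y \<in> R" "e > 0" "ball y e \<inter> R \<subseteq> A n"
proof -
  interpret Metric_space R dist
    by unfold_locales (auto simp: dist_commute dist_triangle)
  have top: "mtopology = top_of_set R"
  proof -
    interpret Submetric UNIV dist R by unfold_locales auto
    show ?thesis using mtopology_submetric by simp
  qed
  have mc: "mcomplete"
  proof -
    interpret Submetric UNIV dist R by unfold_locales auto
    show ?thesis
      using closedin_mcomplete_imp_mcomplete \<open>closed R\<close> complete_UNIV by auto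
  qed
  note out = that
  show thesis
  proof (rule ccontr)
    assume "\<not> thesis"
    then have no: "\<not> ball y e \<inter> R \<subseteq> A n" if "y \<in> R" "e > 0" for n y e using out[OF that, of n] \<open>\<not> thesis\<close> by blast
    have "mtopology interior_of \<Union>((\<lambda>n. R \<inter> A n) ` UNIV) = {}"
    proof (rule metric_Baire_category_alt[OF mc])
      fix T assume "T \<in> (\<lambda>n. R \<inter> A n) ` UNIV"
      then obtain n where T: "T = R \<inter> A n" by blast
      have "closedin mtopology T" unfolding top T using clo by (metis closedin_closed)
      moreover have "mtopology interior_of T = {}"
      proof (rule ccontr)
        assume "mtopology interior_of T \<noteq> {}"
        then obtain y where "y \<in> mtopology interior_of T" by blast
        then obtain W where W: "openin (top_of_set R) W" "y \<in> W" "W \<subseteq> T"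
          unfolding top interior_of_def by auto
        then obtain U where U: "open U" "W = R \<inter> U" by (auto simp: openin_open)
        then obtain e where "e > 0" "ball y e \<subseteq> U" using W by (metis IntE open_contains_ball)
        then have "ball y e \<inter> R \<subseteq> A n" using U W T by blast
        then show False using no[of y e n] W U \<open>e > 0\<close> by blast
      qed
      ultimately show "closedin mtopology T \<and> mtopology interior_of T = {}" by blast
    qed auto
    moreover have "\<Union>((\<lambda>n. R \<inter> A n) ` UNIV) = R" using cover by blast
    moreover have "mtopology interior_of R = R" unfolding top
      by (metis interior_of_topspace topspace_euclidean_subtopology)
    ultimately show False using \<open>R \<noteq> {}\<close> by simp
  qed
qed

lemma closed_range_inj_imp_bounded_below:
  fixes f :: "'a::banach \<Rightarrow> 'b::banach"
  assumes lin: "bounded_linear f" and "inj f" and "closed (range f)"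
  obtains c where "c > 0" "\<And>x. c * norm x \<le> norm (f x)"
proof -
  interpret f: bounded_linear f by fact
  have "range f \<subseteq> (\<Union>n. closure (f ` cball 0 (real n)))"
  proof
    fix u assume "u \<in> range f"
    then obtain x where x: "u = f x" by blast
    obtain n where "norm x \<le> real n" using real_arch_simple by blast
    then have "u \<in> f ` cball 0 (real n)" using x by auto
    then have "u \<in> closure (f ` cball 0 (real n))" by (rule subsetD[OF closure_subset])
    then show "u \<in> (\<Union>n. closure (f ` cball 0 (real n)))" by (rule UN_I[OF UNIV_I])
  qed
  then obtain n y e where y: "y \<in> range f" and "e > 0" and sub: "ball y e \<inter> range f \<subseteq> closure (f ` cball 0 (real n))"
  proof (rule Baire_closed_cover[OF \<open>closed (range f)\<close>, rotated])
    show "range f \<noteq> {}" by simp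
  qed (simp_all add: closed_closure)
  have near: "\<exists>x. norm x \<le> 2 * real n \<and> norm (v - f x) < d"
    if v: "v \<in> range f" "norm v < e" and "d > 0" for v d
  proof -
    obtain a b where ab: "y = f a" "v = f b" using y v by blast
    then have "y + v \<in> range f" by (metis f.add rangeI)
    then have "y + v \<in> closure (f ` cball 0 (real n))" using v by (intro subsetD[OF sub] IntI) (simp_all add: dist_norm)
    then obtain x1 where x1: "norm x1 \<le> n" "dist (f x1) (y + v) < d/2"
      using \<open>d > 0\<close> unfolding closure_approachable by (force dest: spec[of _ "d/2"])
    have "y \<in> closure (f ` cball 0 (real n))" using sub y \<open>e > 0\<close> by auto
    then obtain x2 where x2: "norm x2 \<le> n" "dist (f x2) y < d/2"
      using \<open>d > 0\<close> unfolding closure_approachable by (force dest: spec[of _ "d/2"])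
    have "norm (x1 - x2) \<le> 2 * real n" using x1 x2 norm_triangle_ineq4[of x1 x2] by linarith
    moreover have "v - f (x1 - x2) = (f x2 - y) - (f x1 - (y + v))" by (simp add: f.diff)
    then have eq: "norm (v - f (x1 - x2)) = norm ((f x2 - y) - (f x1 - (y + v)))" by (rule arg_cong)
    have "norm (v - f (x1 - x2)) < d"
      unfolding eq using x1 x2 norm_triangle_ineq4[of "f x2 - y" "f x1 - (y + v)"] by (simp add: dist_norm)
    ultimately show ?thesis by blast
  qed
  define K where "K = (4 * real n + 1) / e"
  have "K > 0" using \<open>e > 0\<close> by (simp add: K_def add_pos_nonneg)
  have "\<exists>x. norm x \<le> K * norm v \<and> norm (v - f x) \<le> norm v / 2" if v: "v \<in> range f" for v
  proof (cases "v = 0")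
    case True
    then show ?thesis by (intro exI[of _ 0]) (simp add: f.zero)
  next
    case False
    define s where "s = e / (2 * norm v)"
    have s: "s > 0" using False \<open>e > 0\<close> by (simp add: s_def)
    have "s *\<^sub>R v \<in> range f" using v f.scaleR by (metis imageE rangeI)
    moreover have "norm (s *\<^sub>R v) < e" using False \<open>e > 0\<close> by (simp add: s_def)
    moreover have "s * (norm v / 2) > 0" using False s by simp
    ultimately obtain x where x: "norm x \<le> 2 * real n" "norm (s *\<^sub>R v - f x) < s * (norm v / 2)"
      using near by blast
    have "s *\<^sub>R v - f x = s *\<^sub>R (v - f (x /\<^sub>R s))" using s by (simp add: f.scaleR algebra_simps)
    then have "s * norm (v - f (x /\<^sub>R s)) < s * (norm v / 2)" using x s by (metis abs_of_pos norm_scaleR)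
    then have "norm (v - f (x /\<^sub>R s)) \<le> norm v / 2" using s by (simp add: mult_less_cancel_left_pos)
    moreover have "norm (x /\<^sub>R s) \<le> K * norm v"
    proof -
      have "norm (x /\<^sub>R s) = norm x / s" using s by (simp add: field_simps)
      also have "\<dots> \<le> 2 * real n / s" using x s by (simp add: divide_right_mono)
      also have "\<dots> \<le> K * norm v" using \<open>e > 0\<close> False by (simp add: s_def K_def field_simps)
      finally show ?thesis .
    qed
    ultimately show ?thesis by blast
  qed
  from approx_imp_bounded_below[OF lin \<open>inj f\<close> \<open>K > 0\<close> this]
  have "1 / (2 * K) * norm x \<le> norm (f x)" for x
    using \<open>K > 0\<close> by (simp add: field_simps)
  then show thesis using that[of "1 / (2 * K)"] \<open>K > 0\<close> by simp
qed

lemma surj_perturb: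
  fixes S S' :: "'a::banach \<Rightarrow> 'b::real_normed_vector"
  assumes "linear S" "linear S'" "surj S" and low: "\<And>x. c * norm x \<le> norm (S x)"
    and near: "\<And>x. norm (S' x - S x) \<le> d * norm x" and "0 \<le> d" "d < c"
  shows "surj S'"
proof -
  interpret S: linear S by fact
  interpret S': linear S' by fact
  have "c > 0" using assms by linarith
  obtain G where G: "\<And>y. S (G y) = y" using \<open>surj S\<close> by (metis surj_def)
  have "\<exists>x. S' x = y" for y
  proof -
    have "\<exists>!x. G (y - (S' x - S x)) = x"
    proof (rule banach_fix_type)
      show "0 \<le> d / c" "d / c < 1" using \<open>c > 0\<close> assms by auto
      show "\<forall>x z. dist (G (y - (S' x - S x))) (G (y - (S' z - S z))) \<le> d / c * dist x z"
      proof (intro allI)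
        fix x z
        let ?D = "G (y - (S' x - S x)) - G (y - (S' z - S z))"
        have "c * norm ?D \<le> norm (S ?D)" by (rule low)
        also have "S ?D = - (S' (x - z) - S (x - z))"
          by (simp add: S.diff S'.diff G)
        also have "norm \<dots> \<le> d * norm (x - z)" by (metis near norm_minus_cancel)
        finally show "dist (G (y - (S' x - S x))) (G (y - (S' z - S z))) \<le> d / c * dist x z"
          using \<open>c > 0\<close> by (simp add: dist_norm field_simps)
      qed
    qed
    then obtain x where "G (y - (S' x - S x)) = x" by blast
    then have "S x = y - (S' x - S x)" by (metis G)
    then show ?thesis by (intro exI[of _ x]) simp
  qed
  then show ?thesis by (metis surj_def)
qed

text \<open>Surjectivity is an open and closed condition as long as the operators stay bounded below.\<close>

lemma surj_on_connected:
  fixes S :: "'p::metric_space \<Rightarrow> 'a::banach \<Rightarrow> 'b::real_normed_vector"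
  assumes "connected \<Omega>" and lin: "\<And>l. linear (S l)"
    and lip: "\<And>l m x. norm (S l x - S m x) \<le> dist l m * norm x"
    and low: "\<And>l. l \<in> \<Omega> \<Longrightarrow> \<exists>c>0. \<forall>x. c * norm x \<le> norm (S l x)"
    and "m \<in> \<Omega>" "surj (S m)" "l \<in> \<Omega>"
  shows "surj (S l)"
proof -
  have *: "\<exists>e>0. \<forall>l'. dist l l' < e \<longrightarrow> surj (S l') = surj (S l)" if l: "l \<in> \<Omega>" for l
  proof -
    obtain c where "c > 0" and c: "\<And>x. c * norm x \<le> norm (S l x)" using low l by blast
    have "surj (S l') = surj (S l)" if d: "dist l l' < c/2" for l'
    proof
      assume "surj (S l)"
      then show "surj (S l')"
        using d \<open>c > 0\<close> by (intro surj_perturb[of "S l" "S l'" c "dist l' l"] lin c lip) (auto simp: dist_commute)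
    next
      assume "surj (S l')"
      have "(c/2) * norm x \<le> norm (S l' x)" for x
      proof -
        have "norm (S l x) \<le> norm (S l' x) + norm (S l x - S l' x)"
          using norm_triangle_ineq[of "S l' x" "S l x - S l' x"] by simp
        also have "norm (S l x - S l' x) \<le> c/2 * norm x"
          using lip[of l x l'] d by (meson less_imp_le mult_right_mono norm_ge_zero order_trans)
        finally show ?thesis using c[of x] by simp
      qed
      then show "surj (S l)"
        using d \<open>surj (S l')\<close> by (intro surj_perturb[of "S l'" "S l" "c/2" "dist l l'"] lin lip) auto
    qed
    moreover have "c/2 > 0" using \<open>c > 0\<close> by simp
    ultimately show ?thesis by blast
  qed
  have op: "openin (top_of_set \<Omega>) {l \<in> \<Omega>. surj (S l) = B}" for B
    unfolding openin_euclidean_subtopology_iff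
  proof (intro conjI ballI)
    fix l assume "l \<in> {l \<in> \<Omega>. surj (S l) = B}"
    then have l: "l \<in> \<Omega>" "surj (S l) = B" by auto
    obtain e where "e > 0" "\<And>l'. dist l l' < e \<Longrightarrow> surj (S l') = surj (S l)"
      using *[OF l(1)] by blast
    then show "\<exists>e>0. \<forall>l'\<in>\<Omega>. dist l' l < e \<longrightarrow> l' \<in> {l \<in> \<Omega>. surj (S l) = B}"
      using l by (intro exI[of _ e]) (simp add: dist_commute)
  qed auto
  let ?U = "{l \<in> \<Omega>. surj (S l) = True}"
  have "\<Omega> - ?U = {l \<in> \<Omega>. surj (S l) = False}" by auto
  then have "openin (top_of_set \<Omega>) (\<Omega> - ?U)" using op[of False] by simp
  then have "closedin (top_of_set \<Omega>) ?U"
    unfolding closedin_def by auto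
  moreover have "openin (top_of_set \<Omega>) ?U" by (rule op)
  ultimately have "?U = {} \<or> ?U = \<Omega>" using \<open>connected \<Omega>\<close> by (meson connected_clopen)
  then show ?thesis using assms by blast
qed

section \<open>The Gaussian measure\<close>

definition gaussian :: "complex measure" where
  "gaussian = density lborel (\<lambda>z. ennreal (fock_weight z))"

definition sqn :: "(complex \<Rightarrow> complex) \<Rightarrow> ennreal" where
  "sqn f = (\<integral>\<^sup>+z. ennreal ((cmod (f z))\<^sup>2) \<partial>gaussian)"

lemma fock_weight_nonneg [simp]: "0 \<le> fock_weight z"
  by (simp add: fock_weight_def)

lemma fock_weight_measurable [measurable]: "fock_weight \<in> borel_measurable borel"
  unfolding fock_weight_def by measurable

lemma sets_gaussian [measurable_cong, simp]: "sets gaussian = sets borel"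
  by (simp add: gaussian_def)

lemma space_gaussian [simp]: "space gaussian = UNIV"
  by (simp add: gaussian_def)

lemma nn_integral_gaussian:
  assumes [measurable]: "F \<in> borel_measurable borel"
  shows "(\<integral>\<^sup>+z. F z \<partial>gaussian) = (\<integral>\<^sup>+z. ennreal (fock_weight z) * F z \<partial>lborel)"
  unfolding gaussian_def by (rule nn_integral_density) auto

lemma nn_integral_lborel_plus:
  fixes c :: "'a::euclidean_space"
  assumes [measurable]: "F \<in> borel_measurable borel"
  shows "(\<integral>\<^sup>+z. F (c + z) \<partial>lborel) = (\<integral>\<^sup>+z. F z \<partial>lborel)"
proof -
  have "(\<integral>\<^sup>+z. F z \<partial>lborel) = (\<integral>\<^sup>+z. F z \<partial>(distr lborel borel ((+) c)))"
    by (simp add: lborel_distr_plus)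
  also have "\<dots> = (\<integral>\<^sup>+z. F (c + z) \<partial>lborel)"
    by (rule nn_integral_distr) auto
  finally show ?thesis by simp
qed

lemma nn_integral_lborel_uminus:
  fixes F :: "'a::euclidean_space \<Rightarrow> ennreal"
  assumes [measurable]: "F \<in> borel_measurable borel"
  shows "(\<integral>\<^sup>+z. F (- z) \<partial>lborel) = (\<integral>\<^sup>+z. F z \<partial>lborel)"
proof -
  have eq: "(lborel :: 'a measure) = distr lborel borel (\<lambda>z. - z)"
    using lborel_affine[of "-1::real" "0::'a"] by (simp add: density_1)
  show ?thesis by (subst (2) eq, subst nn_integral_distr) auto
qed

lemma emeasure_gaussian_finite: "emeasure gaussian UNIV < \<infinity>"
proof -
  have 1: "(\<integral>\<^sup>+x. ennreal (exp (- x\<^sup>2)) \<partial>lborel) < \<infinity>"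
  proof -
    define G :: "real \<Rightarrow> ennreal" where "G x = ennreal (exp (- x)) * indicator {0..} x" for x
    have [measurable]: "G \<in> borel_measurable borel" unfolding G_def by measurable
    have G: "(\<integral>\<^sup>+x. G x \<partial>lborel) = 1"
      using nn_integral_has_integral_lebesgue'[OF _ has_integral_exp_minus_to_infinity[of 1 0]]
      by (simp add: G_def)
    have "(\<integral>\<^sup>+x. ennreal (exp (- x\<^sup>2)) \<partial>lborel) \<le> (\<integral>\<^sup>+x. ennreal (exp 1) * (G x + G (- x)) \<partial>lborel)"
    proof (rule nn_integral_mono)
      fix x :: real
      have "0 \<le> (\<bar>x\<bar> - 1)\<^sup>2" by simp
      then have "- x\<^sup>2 \<le> 1 - \<bar>x\<bar>" by (auto simp: power2_eq_square algebra_simps abs_if split: if_splits)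
      then have "exp (- x\<^sup>2) \<le> exp 1 * exp (- \<bar>x\<bar>)" by (simp flip: exp_add)
      then have "ennreal (exp (- x\<^sup>2)) \<le> ennreal (exp 1) * ennreal (exp (- \<bar>x\<bar>))"
        by (simp add: ennreal_leI flip: ennreal_mult')
      also have "ennreal (exp (- \<bar>x\<bar>)) \<le> G x + G (- x)"
        by (cases "x \<ge> 0") (auto simp: G_def)
      finally show "ennreal (exp (- x\<^sup>2)) \<le> ennreal (exp 1) * (G x + G (- x))"
        by (simp add: mult_left_mono)
    qed
    also have "\<dots> = ennreal (exp 1) * (1 + 1)"
      using G nn_integral_lborel_uminus[of G] by (simp add: nn_integral_cmult nn_integral_add)
    also have "\<dots> < \<infinity>" by (simp add: ennreal_mult_less_top)
    finally show ?thesis .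
  qed
  have "emeasure gaussian UNIV = (\<integral>\<^sup>+z. ennreal (fock_weight z) \<partial>lborel)"
    using nn_integral_gaussian[of "\<lambda>_. 1"] by simp
  also have "\<dots> \<le> (\<integral>\<^sup>+(z::complex). (\<Prod>b\<in>Basis. ennreal (exp (- (z \<bullet> b)\<^sup>2))) \<partial>lborel)"
  proof (rule nn_integral_mono)
    fix z :: complex
    have "exp (- (cmod z)\<^sup>2) = exp (- (Re z)\<^sup>2) * exp (- (Im z)\<^sup>2)"
      by (simp add: cmod_power2 flip: exp_add)
    then have "ennreal (exp (- (cmod z)\<^sup>2)) = (\<Prod>b\<in>Basis. ennreal (exp (- (z \<bullet> b)\<^sup>2)))"
      by (simp add: Basis_complex_def ennreal_mult complex_i_not_one[symmetric])
    moreover have "fock_weight z \<le> exp (- (cmod z)\<^sup>2) / 1"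
      unfolding fock_weight_def using pi_gt3 by (intro divide_left_mono) auto
    ultimately show "ennreal (fock_weight z) \<le> (\<Prod>b\<in>Basis. ennreal (exp (- (z \<bullet> b)\<^sup>2)))"
      by (metis div_by_1 ennreal_leI)
  qed
  also have "\<dots> = (\<Prod>b\<in>(Basis::complex set). (\<integral>\<^sup>+x. ennreal (exp (- x\<^sup>2)) \<partial>lborel))"
    by (rule nn_integral_lborel_prod) auto
  also have "\<dots> < \<infinity>"
    using 1 by (simp add: ennreal_mult_less_top Basis_complex_def)
  finally show ?thesis .
qed

lemma gaussian_pos: "emeasure gaussian UNIV > 0"
proof -
  have "emeasure gaussian UNIV \<noteq> 0"
  proof
    assume "emeasure gaussian UNIV = 0"
    then have "(\<integral>\<^sup>+z. ennreal (fock_weight z) \<partial>lborel) = 0"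
      using nn_integral_gaussian[of "\<lambda>_. 1"] by simp
    then have "AE z in lborel. ennreal (fock_weight z) = 0"
      by (subst (asm) nn_integral_0_iff_AE) auto
    then have "AE z in (lborel::complex measure). z \<notin> UNIV"
      by (simp add: fock_weight_def)
    then have "(UNIV :: complex set) \<in> null_sets lborel"
      by (subst AE_iff_null_sets) auto
    then show False by (simp add: null_sets_def)
  qed
  then show ?thesis by (simp add: zero_less_iff_neq_zero)
qed

text \<open>By uniqueness of Haar measure: both orders of integration in
  \<open>\<integral>\<integral> F (u x + y) G y\<close> can be evaluated by translation invariance, and a Gaussian \<open>G\<close> is
  already rotation invariant.\<close>

lemma nn_integral_gaussian_rotate:
  assumes [measurable]: "F \<in> borel_measurable borel" and u: "cmod u = 1"
  shows "(\<integral>\<^sup>+z. F (u * z) \<partial>gaussian) = (\<integral>\<^sup>+z. F z \<partial>gaussian)"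
proof -
  let ?w = "\<lambda>z. ennreal (fock_weight z)"
  define m where "m = (\<integral>\<^sup>+z. ?w z \<partial>lborel)"
  have m: "m = emeasure gaussian UNIV"
    using nn_integral_gaussian[of "\<lambda>_. 1"] by (simp add: m_def)
  have wu: "?w (u * z) = ?w z" for z by (simp add: fock_weight_def norm_mult u)
  have "m \<noteq> 0" using gaussian_pos m by simp
  have u0: "u \<noteq> 0" using u by auto
  have inv: "(\<integral>\<^sup>+z. H (u * z) \<partial>lborel) = (\<integral>\<^sup>+z. H z \<partial>lborel)"
    if [measurable]: "H \<in> borel_measurable borel" for H :: "complex \<Rightarrow> ennreal"
  proof -
    have "m * (\<integral>\<^sup>+x. H (u * x) \<partial>lborel) = (\<integral>\<^sup>+x. (\<integral>\<^sup>+y. H (u * x) * ?w y \<partial>lborel) \<partial>lborel)"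
      by (simp add: nn_integral_cmult nn_integral_multc m_def mult.commute)
    also have "\<dots> = (\<integral>\<^sup>+y. (\<integral>\<^sup>+x. H (u * x) * ?w y \<partial>lborel) \<partial>lborel)"
      by (rule lborel_pair.Fubini') measurable
    also have "\<dots> = (\<integral>\<^sup>+y. (\<integral>\<^sup>+x. H (y + u * x) * ?w y \<partial>lborel) \<partial>lborel)"
    proof (rule nn_integral_cong)
      fix y :: complex
      show "(\<integral>\<^sup>+x. H (u * x) * ?w y \<partial>lborel) = (\<integral>\<^sup>+x. H (y + u * x) * ?w y \<partial>lborel)"
        using nn_integral_lborel_plus[of "\<lambda>x. H (u * x) * ?w y" "y / u"] u0 
        by (simp add: distrib_left)
    qed
    also have "\<dots> = (\<integral>\<^sup>+x. (\<integral>\<^sup>+y. H (y + u * x) * ?w y \<partial>lborel) \<partial>lborel)"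
      by (rule lborel_pair.Fubini') measurable
    also have "\<dots> = (\<integral>\<^sup>+x. (\<integral>\<^sup>+y. H y * ?w (y - u * x) \<partial>lborel) \<partial>lborel)"
    proof (rule nn_integral_cong)
      fix x :: complex
      show "(\<integral>\<^sup>+y. H (y + u * x) * ?w y \<partial>lborel) = (\<integral>\<^sup>+y. H y * ?w (y - u * x) \<partial>lborel)"
        using nn_integral_lborel_plus[of "\<lambda>y. H y * ?w (y - u * x)" "u * x"]
        by (simp add: add.commute)
    qed
    also have "\<dots> = (\<integral>\<^sup>+y. (\<integral>\<^sup>+x. H y * ?w (y - u * x) \<partial>lborel) \<partial>lborel)"
      by (rule lborel_pair.Fubini') measurable
    also have "\<dots> = (\<integral>\<^sup>+y. H y * m \<partial>lborel)"
    proof (rule nn_integral_cong)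
      fix y :: complex
      have "(\<integral>\<^sup>+x. ?w (y - u * x) \<partial>lborel) = (\<integral>\<^sup>+x. ?w (u * (y / u - x)) \<partial>lborel)"
        using u0 by (simp add: right_diff_distrib)
      also have "\<dots> = (\<integral>\<^sup>+x. ?w (y / u + - x) \<partial>lborel)" by (simp add: wu)
      also have "\<dots> = (\<integral>\<^sup>+x. ?w (y / u + x) \<partial>lborel)"
        by (rule nn_integral_lborel_uminus[of "\<lambda>x. ?w (y / u + x)"]) measurable
      also have "\<dots> = m" unfolding m_def by (rule nn_integral_lborel_plus) measurable
      finally show "(\<integral>\<^sup>+x. H y * ?w (y - u * x) \<partial>lborel) = H y * m"
        by (simp add: nn_integral_cmult)
    qed
    also have "\<dots> = m * (\<integral>\<^sup>+y. H y \<partial>lborel)" by (subst nn_integral_multc) (simp_all add: mult.commute)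
    finally show ?thesis
      using \<open>m \<noteq> 0\<close> emeasure_gaussian_finite m by (auto simp: ennreal_mult_cancel_left)
  qed
  have "(\<integral>\<^sup>+z. F (u * z) \<partial>gaussian) = (\<integral>\<^sup>+z. ?w (u * z) * F (u * z) \<partial>lborel)"
    by (simp add: nn_integral_gaussian wu)
  also have "\<dots> = (\<integral>\<^sup>+z. ?w z * F z \<partial>lborel)" by (rule inv) measurable
  also have "\<dots> = (\<integral>\<^sup>+z. F z \<partial>gaussian)" by (simp add: nn_integral_gaussian)
  finally show ?thesis .
qed

interpretation gaussian: finite_measure gaussian
  by (rule finite_measureI) (use emeasure_gaussian_finite in simp)

lemma nn_integral_gaussian_average:
  assumes [measurable]: "F \<in> borel_measurable borel" "c \<in> borel_measurable borel"
    and c: "\<And>t::real. cmod (c t) = 1"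
  shows "(\<integral>\<^sup>+z. (\<integral>\<^sup>+t\<in>{0..1}. F (c t * z) \<partial>lborel) \<partial>gaussian) = (\<integral>\<^sup>+z. F z \<partial>gaussian)"
proof -
  interpret P: pair_sigma_finite lborel gaussian ..
  have "(\<integral>\<^sup>+z. (\<integral>\<^sup>+t\<in>{0..1}. F (c t * z) \<partial>lborel) \<partial>gaussian)
      = (\<integral>\<^sup>+t. (\<integral>\<^sup>+z. F (c t * z) * indicator {0..1} t \<partial>gaussian) \<partial>lborel)"
    by (rule P.Fubini') measurable
  also have "\<dots> = (\<integral>\<^sup>+(t::real). (\<integral>\<^sup>+z. F z \<partial>gaussian) * indicator {0..1} t \<partial>lborel)"
    by (intro nn_integral_cong) (simp add: nn_integral_multc nn_integral_gaussian_rotate c)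
  also have "\<dots> = (\<integral>\<^sup>+z. F z \<partial>gaussian)" by (simp add: nn_integral_cmult)
  finally show ?thesis .
qed

lemma mean_value_circle:
  assumes "continuous_on (cball 0 1) f" "f holomorphic_on ball 0 1"
  shows "((\<lambda>t. f (exp (2 * of_real pi * \<i> * of_real t))) has_integral f 0) {0..1}"
proof -
  have "((\<lambda>u. f u / (u - 0)) has_contour_integral (2 * of_real pi * \<i> * f 0)) (circlepath 0 1)"
    by (rule Cauchy_integral_circlepath[OF assms]) simp
  then have "((\<lambda>t. f (circlepath 0 1 t) / (circlepath 0 1 t - 0) * vector_derivative (circlepath 0 1) (at t within {0..1})) has_integral 2 * of_real pi * \<i> * f 0) {0..1}"
    unfolding has_contour_integral_def .
  then have "((\<lambda>t. 2 * of_real pi * \<i> * f (exp (2 * of_real pi * \<i> * of_real t))) has_integral 2 * of_real pi * \<i> * f 0) {0..1}"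
  proof (rule has_integral_eq[rotated])
    fix t :: real assume "t \<in> {0..1}"
    then show "f (circlepath 0 1 t) / (circlepath 0 1 t - 0) * vector_derivative (circlepath 0 1) (at t within {0..1})
        = 2 * of_real pi * \<i> * f (exp (2 * of_real pi * \<i> * of_real t))"
      by (subst vector_derivative_circlepath01) (auto simp: circlepath)
  qed
  from has_integral_mult_right[OF this, of "1 / (2 * of_real pi * \<i>)"] show ?thesis by simp
qed

lemma nn_pythagoras:
  fixes g :: "real \<Rightarrow> complex"
  assumes g: "continuous_on {0..1} g" and i: "(g has_integral A) {0..1}"
  shows "(\<integral>\<^sup>+t\<in>{0..1}. ennreal ((cmod (g t))\<^sup>2) \<partial>lborel)
       = ennreal ((cmod A)\<^sup>2) + (\<integral>\<^sup>+t\<in>{0..1}. ennreal ((cmod (g t - A))\<^sup>2) \<partial>lborel)"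
proof -
  define I where "I = integral {0..1} (\<lambda>t. (cmod (g t - A))\<^sup>2)"
  have d: "((\<lambda>t. (cmod (g t - A))\<^sup>2) has_integral I) {0..1}"
    unfolding I_def
    by (intro integrable_integral integrable_continuous_real continuous_intros g)
  have "((\<lambda>t. Re (cnj A * (g t - A))) has_integral Re (cnj A * (A - A * of_real 1))) {0..1}"
    using has_integral_const_real[of A 0 1]
    by (intro has_integral_Re has_integral_mult_right has_integral_diff i) simp
  then have e: "((\<lambda>t. 2 * Re (cnj A * (g t - A))) has_integral 0) {0..1}"
    by (rule has_integral_eq_rhs[OF has_integral_mult_right]) simp
  have "((\<lambda>t. (cmod A)\<^sup>2 + (cmod (g t - A))\<^sup>2 + 2 * Re (cnj A * (g t - A))) has_integral (cmod A)\<^sup>2 + I + 0) {0..1}"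
    using has_integral_const_real[of "(cmod A)\<^sup>2" 0 1]
    by (intro has_integral_add d e) simp
  moreover have "(cmod A)\<^sup>2 + (cmod (w - A))\<^sup>2 + 2 * Re (cnj A * (w - A)) = (cmod w)\<^sup>2" for w
    unfolding cmod_power2 by (simp add: power2_eq_square algebra_simps)
  ultimately have "((\<lambda>t. (cmod (g t))\<^sup>2) has_integral (cmod A)\<^sup>2 + I) {0..1}"
    by simp
  moreover have "I \<ge> 0" unfolding I_def by (intro integral_nonneg has_integral_integrable[OF d]) auto
  ultimately show ?thesis
    using d by (simp add: nn_integral_has_integral_lebesgue'[where \<Omega> = "{0..1}"])
qed

lemma sqn_pythagoras:
  assumes h: "h holomorphic_on UNIV"
  shows "sqn h = ennreal ((cmod (h 0))\<^sup>2) * emeasure gaussian UNIV + sqn (\<lambda>z. h z - h 0)"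
proof -
  let ?u = "\<lambda>t::real. exp (2 * of_real pi * \<i> * of_real t) :: complex"
  have cont: "continuous_on A h" for A
    using h holomorphic_on_imp_continuous_on continuous_on_subset by blast
  have [measurable]: "h \<in> borel_measurable borel" using cont by (rule borel_measurable_continuous_onI)
  have u1: "cmod (?u t) = 1" for t by (simp add: norm_exp_eq_Re)
  have [measurable]: "?u \<in> borel_measurable borel" by (intro borel_measurable_continuous_onI continuous_intros)
  have ptw: "(\<integral>\<^sup>+t\<in>{0..1}. ennreal ((cmod (h (?u t * z)))\<^sup>2) \<partial>lborel) = ennreal ((cmod (h 0))\<^sup>2) + (\<integral>\<^sup>+t\<in>{0..1}. ennreal ((cmod (h (?u t * z) - h 0))\<^sup>2) \<partial>lborel)" for z
  proof (rule nn_pythagoras)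
    show "continuous_on {0..1} (\<lambda>t. h (?u t * z))"
      by (intro continuous_on_compose2[OF cont[of UNIV]] continuous_intros) auto
    have "(\<lambda>w. h (w * z)) holomorphic_on UNIV"
      by (rule holomorphic_on_compose_gen[OF _ h, unfolded o_def]) (auto intro: holomorphic_intros)
    from mean_value_circle[OF holomorphic_on_imp_continuous_on[OF holomorphic_on_subset[OF this]] holomorphic_on_subset[OF this]]
    show "((\<lambda>t. h (?u t * z)) has_integral h 0) {0..1}" by simp
  qed
  have "sqn h = (\<integral>\<^sup>+z. (\<integral>\<^sup>+t\<in>{0..1}. ennreal ((cmod (h (?u t * z)))\<^sup>2) \<partial>lborel) \<partial>gaussian)"
    unfolding sqn_def by (rule nn_integral_gaussian_average[symmetric]) (use u1 in auto)
  also have "\<dots> = (\<integral>\<^sup>+z. ennreal ((cmod (h 0))\<^sup>2) + (\<integral>\<^sup>+t\<in>{0..1}. ennreal ((cmod (h (?u t * z) - h 0))\<^sup>2) \<partial>lborel) \<partial>gaussian)"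
    by (simp only: ptw)
  also have "\<dots> = ennreal ((cmod (h 0))\<^sup>2) * emeasure gaussian UNIV + (\<integral>\<^sup>+z. (\<integral>\<^sup>+t\<in>{0..1}. ennreal ((cmod (h (?u t * z) - h 0))\<^sup>2) \<partial>lborel) \<partial>gaussian)"
    by (subst nn_integral_add) (auto intro!: lborel.borel_measurable_nn_integral)
  also have "(\<integral>\<^sup>+z. (\<integral>\<^sup>+t\<in>{0..1}. ennreal ((cmod (h (?u t * z) - h 0))\<^sup>2) \<partial>lborel) \<partial>gaussian) = sqn (\<lambda>z. h z - h 0)"
    unfolding sqn_def
    by (rule nn_integral_gaussian_average[where F = "\<lambda>z. ennreal ((cmod (h z - h 0))\<^sup>2)"]) (use u1 in auto)
  finally show ?thesis .
qed

lemma moebius_unit_circle: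
  assumes "cmod u = 1" "cmod a < 1"
  shows "1 + cnj a * u \<noteq> 0" "cmod ((u + a) / (1 + cnj a * u)) = 1"
proof -
  have "cmod (cnj a * u) < 1" using assms by (simp add: norm_mult)
  then show nz: "1 + cnj a * u \<noteq> 0" by (metis add_eq_0_iff2 less_irrefl norm_minus_cancel norm_one)
  have "u * cnj u = 1" using assms by (simp add: complex_norm_square[symmetric])
  then have "u * cnj (1 + cnj a * u) = u + a" by (simp add: algebra_simps)
  then have "cmod (u + a) = cmod (1 + cnj a * u)"
    by (metis assms(1) complex_mod_cnj mult_1 norm_mult)
  then show "cmod ((u + a) / (1 + cnj a * u)) = 1" using nz by (simp add: norm_divide)
qed

text \<open>The value at \<open>a\<close> is the mean over the unit circle after precomposition with the
  disc automorphism that moves \<open>0\<close> to \<open>a\<close>; Jensen and rotation invariance do the rest.\<close>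

lemma sqn_dilate_le:
  assumes h: "h holomorphic_on UNIV" and a: "cmod a < 1"
  shows "sqn (\<lambda>z. h (a * z)) \<le> sqn h"
proof -
  define m where "m w = (w + a) / (1 + cnj a * w)" for w
  define c where "c t = m (exp (2 * of_real pi * \<i> * of_real t))" for t :: real
  have u1: "cmod (exp (2 * of_real pi * \<i> * of_real t)) = 1" for t by (simp add: norm_exp_eq_Re)
  have c1: "cmod (c t) = 1" for t
    unfolding c_def m_def by (rule moebius_unit_circle(2)[OF u1 a])
  have cc: "continuous_on UNIV c"
    unfolding c_def m_def using moebius_unit_circle(1)[OF u1 a] by (intro continuous_intros) auto
  have [measurable]: "c \<in> borel_measurable borel" using cc by (rule borel_measurable_continuous_onI)
  have cont: "continuous_on A h" for A
    using h holomorphic_on_imp_continuous_on continuous_on_subset by blast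
  have [measurable]: "h \<in> borel_measurable borel" using cont by (rule borel_measurable_continuous_onI)
  have m_hol: "m holomorphic_on cball 0 1"
  proof -
    have "1 + cnj a * w \<noteq> 0" if "w \<in> cball 0 1" for w
    proof
      assume "1 + cnj a * w = 0"
      then have "cmod (cnj a * w) = 1" by (metis add_eq_0_iff norm_minus_cancel norm_one)
      moreover have "cmod (cnj a * w) \<le> cmod a * 1"
        using that by (simp add: norm_mult mult_left_le)
      ultimately show False using a by simp
    qed
    then show ?thesis unfolding m_def by (auto intro!: holomorphic_intros)
  qed
  have ptw: "ennreal ((cmod (h (a * z)))\<^sup>2) \<le> (\<integral>\<^sup>+t\<in>{0..1}. ennreal ((cmod (h (c t * z)))\<^sup>2) \<partial>lborel)" for z
  proof -
    have hol: "(\<lambda>w. h (m w * z)) holomorphic_on cball 0 1"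
      by (rule holomorphic_on_compose_gen[OF _ h, unfolded o_def]) (auto intro: holomorphic_intros m_hol)
    have "((\<lambda>t. h (c t * z)) has_integral h (m 0 * z)) {0..1}"
      unfolding c_def
      by (rule mean_value_circle[OF holomorphic_on_imp_continuous_on[OF hol] holomorphic_on_subset[OF hol]]) auto
    then have i: "((\<lambda>t. h (c t * z)) has_integral h (a * z)) {0..1}" by (simp add: m_def)
    have "continuous_on {0..1} (\<lambda>t. h (c t * z))"
      by (intro continuous_on_compose2[OF cont[of UNIV]] continuous_intros continuous_on_subset[OF cc]) auto
    from nn_pythagoras[OF this i] show ?thesis by simp
  qed
  have "sqn (\<lambda>z. h (a * z)) \<le> (\<integral>\<^sup>+z. (\<integral>\<^sup>+t\<in>{0..1}. ennreal ((cmod (h (c t * z)))\<^sup>2) \<partial>lborel) \<partial>gaussian)"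
    unfolding sqn_def by (intro nn_integral_mono ptw)
  also have "\<dots> = sqn h"
    unfolding sqn_def by (rule nn_integral_gaussian_average[where F = "\<lambda>z. ennreal ((cmod (h z))\<^sup>2)"]) (use c1 in auto)
  finally show ?thesis .
qed

section \<open>The Fock space\<close>

lemma continuous_on_entire: "f holomorphic_on UNIV \<Longrightarrow> continuous_on A f"
  using holomorphic_on_imp_continuous_on continuous_on_subset by blast

lemma borel_measurable_entire: "f holomorphic_on UNIV \<Longrightarrow> f \<in> borel_measurable borel"
  by (intro borel_measurable_continuous_onI continuous_on_entire)

lemma sqn_eq:
  assumes [measurable]: "f \<in> borel_measurable borel"
  shows "sqn f = (\<integral>\<^sup>+z. ennreal ((cmod (f z))\<^sup>2 * fock_weight z) \<partial>lborel)"
  unfolding sqn_def by (subst nn_integral_gaussian) (auto simp: ennreal_mult' mult.commute)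

lemma F2_imp_holomorphic: "f \<in> F2 \<Longrightarrow> f holomorphic_on UNIV"
  by (simp add: F2_def)

lemma F2_imp_sqn:
  assumes "f \<in> F2"
  shows "sqn f = ennreal ((fock_norm f)\<^sup>2)"
proof -
  have [measurable]: "f \<in> borel_measurable borel"
    by (intro borel_measurable_entire F2_imp_holomorphic assms)
  let ?F = "\<lambda>z. (cmod (f z))\<^sup>2 * fock_weight z"
  have "(?F has_integral integral UNIV ?F) UNIV"
    using assms by (auto simp: F2_def)
  then have "sqn f = ennreal (integral UNIV ?F)"
    unfolding sqn_eq[OF \<open>f \<in> borel_measurable borel\<close>] by (intro nn_integral_has_integral_lborel) auto
  moreover have "integral UNIV ?F \<ge> 0" by (rule integral_nonneg) (use assms in \<open>auto simp: F2_def\<close>)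
  ultimately show ?thesis by (simp add: fock_norm_def)
qed

lemma F2_iff: "f \<in> F2 \<longleftrightarrow> f holomorphic_on UNIV \<and> sqn f < \<infinity>"
proof
  assume "f \<in> F2"
  then show "f holomorphic_on UNIV \<and> sqn f < \<infinity>"
    by (simp add: F2_imp_holomorphic F2_imp_sqn)
next
  assume *: "f holomorphic_on UNIV \<and> sqn f < \<infinity>"
  then have [measurable]: "f \<in> borel_measurable borel" by (intro borel_measurable_entire) auto
  have "(\<lambda>z. (cmod (f z))\<^sup>2 * fock_weight z) integrable_on UNIV"
    by (rule nn_integral_integrable_on) (use * in \<open>auto simp: sqn_eq\<close>)
  then show "f \<in> F2" using * by (simp add: F2_def)
qed

lemma fock_norm_nonneg [simp]: "0 \<le> fock_norm f"
proof -
  have "0 \<le> integral UNIV (\<lambda>z. (cmod (f z))\<^sup>2 * fock_weight z)"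
    by (cases "(\<lambda>z. (cmod (f z))\<^sup>2 * fock_weight z) integrable_on UNIV")
       (auto intro: integral_nonneg simp: not_integrable_integral)
  then show ?thesis by (simp add: fock_norm_def)
qed

lemma fock_norm_leI:
  assumes "f \<in> F2" "0 \<le> r" "sqn f \<le> ennreal (r\<^sup>2)"
  shows "fock_norm f \<le> r"
  using assms by (simp add: F2_imp_sqn power2_le_iff_abs_le)

lemma fock_norm_cmult: "fock_norm (\<lambda>z. c * f z) = cmod c * fock_norm f"
  unfolding fock_norm_def by (simp add: norm_mult power_mult_distrib mult.assoc real_sqrt_mult)

lemma sqn_cmult:
  assumes "f \<in> borel_measurable borel"
  shows "sqn (\<lambda>z. c * f z) = ennreal ((cmod c)\<^sup>2) * sqn f"
  using assms unfolding sqn_def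
  by (simp add: norm_mult power_mult_distrib ennreal_mult' nn_integral_cmult)

lemma F2_cmult: "f \<in> F2 \<Longrightarrow> (\<lambda>z. c * f z) \<in> F2"
  by (auto simp: F2_iff sqn_cmult borel_measurable_entire ennreal_mult_less_top intro!: holomorphic_intros)

lemma sqn_add_le:
  assumes f: "f \<in> borel_measurable borel" and g: "g \<in> borel_measurable borel" and "t > 0"
  shows "sqn (\<lambda>z. f z + g z) \<le> ennreal (1 + t) * sqn f + ennreal (1 + 1/t) * sqn g"
proof -
  have [measurable]: "f \<in> borel_measurable borel" "g \<in> borel_measurable borel" by fact+
  have "sqn (\<lambda>z. f z + g z) \<le> (\<integral>\<^sup>+z. ennreal (1 + t) * ennreal ((cmod (f z))\<^sup>2) + ennreal (1 + 1/t) * ennreal ((cmod (g z))\<^sup>2) \<partial>gaussian)"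
    unfolding sqn_def
  proof (rule nn_integral_mono)
    fix z
    define x y where "x = cmod (f z)" and "y = cmod (g z)"
    have "0 \<le> (t * x - y)\<^sup>2 / t" using \<open>t > 0\<close> by simp
    also have "(t * x - y)\<^sup>2 / t = t * x\<^sup>2 + y\<^sup>2 / t - 2 * x * y"
      using \<open>t > 0\<close> by (simp add: field_simps power2_eq_square)
    finally have "(x + y)\<^sup>2 \<le> (1 + t) * x\<^sup>2 + (1 + 1/t) * y\<^sup>2"
      by (simp add: power2_sum algebra_simps)
    moreover have "(cmod (f z + g z))\<^sup>2 \<le> (x + y)\<^sup>2"
      unfolding x_def y_def by (intro power_mono norm_triangle_ineq) simp
    ultimately have "ennreal ((cmod (f z + g z))\<^sup>2) \<le> ennreal ((1 + t) * x\<^sup>2 + (1 + 1/t) * y\<^sup>2)"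
      by (intro ennreal_leI) linarith
    also have "\<dots> = ennreal (1 + t) * ennreal (x\<^sup>2) + ennreal (1 + 1/t) * ennreal (y\<^sup>2)"
      using \<open>t > 0\<close> by (simp add: ennreal_mult)
    finally show "ennreal ((cmod (f z + g z))\<^sup>2) \<le> ennreal (1 + t) * ennreal ((cmod (f z))\<^sup>2) + ennreal (1 + 1/t) * ennreal ((cmod (g z))\<^sup>2)"
      by (simp add: x_def y_def)
  qed
  also have "\<dots> = ennreal (1 + t) * sqn f + ennreal (1 + 1/t) * sqn g"
    unfolding sqn_def by (simp add: nn_integral_add nn_integral_cmult)
  finally show ?thesis .
qed

lemma F2_add:
  assumes "f \<in> F2" "g \<in> F2"
  shows "(\<lambda>z. f z + g z) \<in> F2"
proof -
  have "sqn (\<lambda>z. f z + g z) \<le> ennreal (1 + 1) * sqn f + ennreal (1 + 1/1) * sqn g"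
    using assms by (intro sqn_add_le borel_measurable_entire F2_imp_holomorphic) auto
  also have "\<dots> < \<infinity>" using assms by (simp add: F2_iff ennreal_mult_less_top)
  finally show ?thesis using assms by (auto simp: F2_iff intro!: holomorphic_intros)
qed

lemma F2_zero: "(\<lambda>z. 0) \<in> F2"
  by (simp add: F2_iff sqn_def)

lemma F2_uminus: "f \<in> F2 \<Longrightarrow> (\<lambda>z. - f z) \<in> F2"
  using F2_cmult[of f "-1"] by simp

lemma F2_diff: "f \<in> F2 \<Longrightarrow> g \<in> F2 \<Longrightarrow> (\<lambda>z. f z - g z) \<in> F2"
  using F2_add[of f "\<lambda>z. - g z"] F2_uminus[of g] by simp

lemma F2_const: "(\<lambda>z. c) \<in> F2"
  using emeasure_gaussian_finite by (simp add: F2_iff sqn_def ennreal_mult_less_top)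

lemma fock_norm_triangle:
  assumes f: "f \<in> F2" and g: "g \<in> F2"
  shows "fock_norm (\<lambda>z. f z + g z) \<le> fock_norm f + fock_norm g"
proof (rule field_le_epsilon)
  fix e :: real assume "e > 0"
  define A where "A = fock_norm f + e / 2"
  define B where "B = fock_norm g + e / 2"
  have A: "0 < A" and B: "0 < B" using \<open>e > 0\<close> by (simp_all add: A_def B_def add_nonneg_pos)
  have sf: "sqn f \<le> ennreal (A\<^sup>2)" and sg: "sqn g \<le> ennreal (B\<^sup>2)"
    using \<open>e > 0\<close> by (auto simp: F2_imp_sqn f g A_def B_def intro!: ennreal_leI power_mono)
  have "sqn (\<lambda>z. f z + g z) \<le> ennreal (1 + B/A) * sqn f + ennreal (1 + 1/(B/A)) * sqn g"
    using f g A B by (intro sqn_add_le borel_measurable_entire F2_imp_holomorphic) auto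
  also have "\<dots> \<le> ennreal (1 + B/A) * ennreal (A\<^sup>2) + ennreal (1 + 1/(B/A)) * ennreal (B\<^sup>2)"
    by (intro add_mono mult_left_mono sf sg) auto
  also have "\<dots> = ennreal ((1 + B/A) * A\<^sup>2 + (1 + 1/(B/A)) * B\<^sup>2)"
    using A B by (simp add: ennreal_mult)
  also have "(1 + B/A) * A\<^sup>2 + (1 + 1/(B/A)) * B\<^sup>2 = (A + B)\<^sup>2"
    using A B by (simp add: field_simps power2_eq_square)
  finally have "fock_norm (\<lambda>z. f z + g z) \<le> A + B"
    using A B by (intro fock_norm_leI F2_add f g) auto
  then show "fock_norm (\<lambda>z. f z + g z) \<le> fock_norm f + fock_norm g + e"
    by (simp add: A_def B_def)
qed

text \<open>Up to a factor this is the unitary Weyl operator that moves the point \<open>p\<close> to the origin.\<close>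

definition weyl :: "complex \<Rightarrow> (complex \<Rightarrow> complex) \<Rightarrow> complex \<Rightarrow> complex" where
  "weyl p f z = exp (- cnj p * z) * f (z + p)"

lemma weyl_0 [simp]: "weyl p f 0 = f p"
  by (simp add: weyl_def)

lemma holomorphic_weyl: "f holomorphic_on UNIV \<Longrightarrow> weyl p f holomorphic_on UNIV"
  unfolding weyl_def
  by (intro holomorphic_intros holomorphic_on_compose_gen[of "\<lambda>z. z + p" UNIV f UNIV, unfolded o_def]) auto

lemma sqn_weyl:
  assumes [measurable]: "f \<in> borel_measurable borel"
  shows "sqn (weyl p f) = ennreal (exp ((cmod p)\<^sup>2)) * sqn f"
proof -
  have [measurable]: "weyl p f \<in> borel_measurable borel" unfolding weyl_def by measurable
  have *: "(cmod (weyl p f z))\<^sup>2 * fock_weight z = exp ((cmod p)\<^sup>2) * ((cmod (f (z + p)))\<^sup>2 * fock_weight (z + p))" for z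
  proof -
    have "(cmod (exp (- cnj p * z)))\<^sup>2 = exp (- 2 * Re (cnj p * z))"
      by (simp add: exp_double[symmetric] norm_exp_eq_Re)
    moreover have "- 2 * Re (cnj p * z) + - (cmod z)\<^sup>2 = (cmod p)\<^sup>2 + - (cmod (z + p))\<^sup>2"
      unfolding cmod_power2 by (simp add: power2_eq_square algebra_simps)
    ultimately have "(cmod (exp (- cnj p * z)))\<^sup>2 * exp (- (cmod z)\<^sup>2) = exp ((cmod p)\<^sup>2) * exp (- (cmod (z + p))\<^sup>2)"
      by (simp only: exp_add[symmetric])
    then show ?thesis
      by (simp add: weyl_def fock_weight_def norm_mult power_mult_distrib mult_ac)
  qed
  have "sqn (weyl p f) = (\<integral>\<^sup>+z. ennreal (exp ((cmod p)\<^sup>2)) * ennreal ((cmod (f (p + z)))\<^sup>2 * fock_weight (p + z)) \<partial>lborel)"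
    by (simp add: sqn_eq * ennreal_mult' add.commute)
  also have "\<dots> = ennreal (exp ((cmod p)\<^sup>2)) * (\<integral>\<^sup>+z. ennreal ((cmod (f (p + z)))\<^sup>2 * fock_weight (p + z)) \<partial>lborel)"
    by (rule nn_integral_cmult) measurable
  also have "(\<integral>\<^sup>+z. ennreal ((cmod (f (p + z)))\<^sup>2 * fock_weight (p + z)) \<partial>lborel) = sqn f"
    unfolding sqn_eq[OF assms] by (rule nn_integral_lborel_plus) measurable
  finally show ?thesis .
qed

lemma F2_eval_le:
  obtains C where "\<And>f p. f \<in> F2 \<Longrightarrow> cmod p \<le> R \<Longrightarrow> cmod (f p) \<le> C * fock_norm f"
proof
  fix f p assume f: "f \<in> F2" and p: "cmod p \<le> R"
  note hf = F2_imp_holomorphic[OF f]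
  define m where "m = measure gaussian UNIV"
  have em: "emeasure gaussian UNIV = ennreal m" unfolding m_def by (rule gaussian.emeasure_eq_measure)
  then have m: "m > 0" using gaussian_pos by simp
  have "ennreal ((cmod (f p))\<^sup>2 * m) \<le> sqn (weyl p f)"
    using sqn_pythagoras[OF holomorphic_weyl[OF hf], of p] m by (simp add: em ennreal_mult)
  also have "\<dots> = ennreal (exp ((cmod p)\<^sup>2) * (fock_norm f)\<^sup>2)"
    by (simp add: sqn_weyl borel_measurable_entire hf F2_imp_sqn f ennreal_mult)
  finally have "(cmod (f p))\<^sup>2 * m \<le> exp ((cmod p)\<^sup>2) * (fock_norm f)\<^sup>2" by simp
  also have "\<dots> \<le> exp (R\<^sup>2) * (fock_norm f)\<^sup>2"
    using p by (intro mult_right_mono) (auto intro: power_mono)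
  finally have "(cmod (f p))\<^sup>2 \<le> (exp (R\<^sup>2) / m) * (fock_norm f)\<^sup>2"
    using m by (simp add: field_simps)
  then have "sqrt ((cmod (f p))\<^sup>2) \<le> sqrt ((exp (R\<^sup>2) / m) * (fock_norm f)\<^sup>2)" by (rule real_sqrt_le_mono)
  then show "cmod (f p) \<le> sqrt (exp (R\<^sup>2) / measure gaussian UNIV) * fock_norm f"
    unfolding real_sqrt_mult real_sqrt_abs m_def by simp
qed

lemma fock_norm_eq_0:
  assumes "f \<in> F2"
  shows "fock_norm f = 0 \<longleftrightarrow> f = (\<lambda>z. 0)"
proof
  assume 0: "fock_norm f = 0"
  show "f = (\<lambda>z. 0)"
  proof
    fix p
    obtain C where "\<And>g q. g \<in> F2 \<Longrightarrow> cmod q \<le> cmod p \<Longrightarrow> cmod (g q) \<le> C * fock_norm g"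
      using F2_eval_le by blast
    from this[OF assms, of p] show "f p = 0" using 0 by simp
  qed
qed (simp add: fock_norm_def)

typedef fock = F2
  using F2_zero by blast

setup_lifting type_definition_fock

instantiation fock :: real_normed_vector
begin

lift_definition zero_fock :: fock is "\<lambda>z. 0" by (rule F2_zero)
lift_definition plus_fock :: "fock \<Rightarrow> fock \<Rightarrow> fock" is "\<lambda>f g z. f z + g z" by (rule F2_add)
lift_definition minus_fock :: "fock \<Rightarrow> fock \<Rightarrow> fock" is "\<lambda>f g z. f z - g z" by (rule F2_diff)
lift_definition uminus_fock :: "fock \<Rightarrow> fock" is "\<lambda>f z. - f z" by (rule F2_uminus)
lift_definition scaleR_fock :: "real \<Rightarrow> fock \<Rightarrow> fock" is "\<lambda>r f z. of_real r * f z" by (rule F2_cmult)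
lift_definition norm_fock :: "fock \<Rightarrow> real" is fock_norm .

definition sgn_fock :: "fock \<Rightarrow> fock" where "sgn_fock x = inverse (norm x) *\<^sub>R x"
definition dist_fock :: "fock \<Rightarrow> fock \<Rightarrow> real" where "dist_fock x y = norm (x - y)"
definition uniformity_fock :: "(fock \<times> fock) filter"
  where "uniformity_fock = (INF e\<in>{0<..}. principal {(x, y). dist x y < e})"
definition open_fock :: "fock set \<Rightarrow> bool"
  where "open_fock U \<longleftrightarrow> (\<forall>x\<in>U. \<forall>\<^sub>F (x', y) in uniformity. x' = x \<longrightarrow> y \<in> U)"

instance
proof
  fix x y z :: fock and a b :: real
  show "x + y + z = x + (y + z)" by transfer (simp add: algebra_simps)
  show "x + y = y + x" by transfer (simp add: algebra_simps)
  show "0 + x = x" by transfer simp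
  show "- x + x = 0" by transfer simp
  show "x - y = x + - y" by transfer simp
  show "a *\<^sub>R (x + y) = a *\<^sub>R x + a *\<^sub>R y" by transfer (simp add: algebra_simps)
  show "(a + b) *\<^sub>R x = a *\<^sub>R x + b *\<^sub>R x" by transfer (simp add: algebra_simps)
  show "a *\<^sub>R b *\<^sub>R x = (a * b) *\<^sub>R x" by transfer (simp add: algebra_simps)
  show "1 *\<^sub>R x = x" by transfer simp
  show "norm x = 0 \<longleftrightarrow> x = 0" by transfer (rule fock_norm_eq_0)
  show "norm (x + y) \<le> norm x + norm y" by transfer (rule fock_norm_triangle)
  show "norm (a *\<^sub>R x) = \<bar>a\<bar> * norm x" by transfer (simp add: fock_norm_cmult)
qed (simp_all add: sgn_fock_def dist_fock_def uniformity_fock_def open_fock_def)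

end

text \<open>Evaluation bounds make Cauchy sequences converge locally uniformly, so the limit is entire;
  Fatou's lemma gives convergence in norm.\<close>

lemma fock_Cauchy_convergent:
  fixes X :: "nat \<Rightarrow> fock"
  assumes "Cauchy X"
  shows "convergent X"
proof -
  define F where "F n = Rep_fock (X n)" for n
  have F: "F n \<in> F2" for n by (simp add: F_def Rep_fock)
  have dist_eq: "dist (X n) (X k) = fock_norm (\<lambda>z. F n z - F k z)" for n k
    by (simp add: dist_norm norm_fock.rep_eq minus_fock.rep_eq F_def)
  have uc: "uniformly_convergent_on (cball 0 R) F" for R
  proof (rule Cauchy_uniformly_convergent)
    obtain C where C: "\<And>f p. f \<in> F2 \<Longrightarrow> cmod p \<le> R \<Longrightarrow> cmod (f p) \<le> C * fock_norm f"
      using F2_eval_le by blast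
    show "uniformly_Cauchy_on (cball 0 R) F"
    proof (rule uniformly_Cauchy_onI)
      fix e :: real assume "e > 0"
      define d where "d = e / (\<bar>C\<bar> + 1)"
      have "d > 0" using \<open>e > 0\<close> by (simp add: d_def add_nonneg_pos)
      then obtain N where N: "\<And>n k. n \<ge> N \<Longrightarrow> k \<ge> N \<Longrightarrow> dist (X n) (X k) < d"
        using \<open>Cauchy X\<close> unfolding Cauchy_def by blast
      have "dist (F n z) (F k z) < e" if "z \<in> cball 0 R" "n \<ge> N" "k \<ge> N" for z n k
      proof -
        have "dist (F n z) (F k z) \<le> C * dist (X n) (X k)"
          using C[OF F2_diff[OF F F], of z n k] that by (simp add: dist_norm[of "F n z"] dist_eq)
        also have "\<dots> \<le> (\<bar>C\<bar> + 1) * dist (X n) (X k)"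
          by (intro mult_right_mono) auto
        also have "\<dots> < (\<bar>C\<bar> + 1) * d" using N that by (intro mult_strict_left_mono) (auto simp: add_nonneg_pos)
        also have "\<dots> = e" by (simp add: d_def add_nonneg_pos pos_le_divide_eq)
        finally show ?thesis .
      qed
      then show "\<exists>M. \<forall>x\<in>cball 0 R. \<forall>m\<ge>M. \<forall>n\<ge>M. dist (F m x) (F n x) < e" by blast
    qed
  qed
  define g where "g z = lim (\<lambda>n. F n z)" for z
  have ul: "uniform_limit (cball 0 R) F g sequentially" for R
    using uc[of R] unfolding uniformly_convergent_uniform_limit_iff g_def .
  have pt: "(\<lambda>n. F n z) \<longlonglongrightarrow> g z" for z
    by (rule tendsto_uniform_limitI[OF ul[of "cmod z"]]) simp
  have g: "g holomorphic_on UNIV"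
  proof -
    have "g holomorphic_on ball 0 R" for R
    proof -
      have "\<forall>\<^sub>F n in sequentially. continuous_on (cball 0 R) (F n) \<and> F n holomorphic_on ball 0 R"
        using F2_imp_holomorphic[OF F] by (intro always_eventually) (auto intro: continuous_on_entire holomorphic_on_subset)
      from holomorphic_uniform_limit[OF this ul] show ?thesis by auto
    qed
    then have "g holomorphic_on (\<Union>R. ball 0 R)"
      by (intro holomorphic_on_UN_open) auto
    moreover have "(\<Union>R. ball (0::complex) R) = UNIV"
    proof (intro equalityI subsetI UNIV_I)
      fix z :: complex
      have "z \<in> ball 0 (cmod z + 1)" by simp
      then show "z \<in> (\<Union>R. ball 0 R)" by blast
    qed
    ultimately show ?thesis by simp
  qed
  have [measurable]: "g \<in> borel_measurable borel" "F n \<in> borel_measurable borel" for n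
    by (intro borel_measurable_entire g F2_imp_holomorphic F)+
  have fatou: "sqn (\<lambda>z. F n z - g z) \<le> ennreal (e\<^sup>2)"
    if k: "\<And>k. k \<ge> N \<Longrightarrow> dist (X n) (X k) \<le> e" for n N e
  proof -
    have "sqn (\<lambda>z. F n z - g z) = (\<integral>\<^sup>+z. liminf (\<lambda>k. ennreal ((cmod (F n z - F k z))\<^sup>2)) \<partial>gaussian)"
      unfolding sqn_def
    proof (rule nn_integral_cong)
      fix z
      have "(\<lambda>k. ennreal ((cmod (F n z - F k z))\<^sup>2)) \<longlonglongrightarrow> ennreal ((cmod (F n z - g z))\<^sup>2)"
        by (intro tendsto_intros pt tendsto_ennrealI)
      then show "ennreal ((cmod (F n z - g z))\<^sup>2) = liminf (\<lambda>k. ennreal ((cmod (F n z - F k z))\<^sup>2))"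
        by (intro lim_imp_Liminf[symmetric]) auto
    qed
    also have "\<dots> \<le> liminf (\<lambda>k. sqn (\<lambda>z. F n z - F k z))"
      unfolding sqn_def by (rule nn_integral_liminf) measurable
    also have "\<dots> \<le> limsup (\<lambda>k. sqn (\<lambda>z. F n z - F k z))"
      by (rule Liminf_le_Limsup) simp
    also have "\<dots> \<le> ennreal (e\<^sup>2)"
    proof (rule Limsup_bounded)
      show "\<forall>\<^sub>F k in sequentially. sqn (\<lambda>z. F n z - F k z) \<le> ennreal (e\<^sup>2)"
        using eventually_ge_at_top[of N]
      proof eventually_elim
        case (elim k)
        then show ?case using k[of k]
          by (simp add: F2_imp_sqn F2_diff F dist_eq ennreal_leI power_mono)
      qed
    qed
    finally show ?thesis .
  qed
  obtain N1 where N1: "\<And>n k. n \<ge> N1 \<Longrightarrow> k \<ge> N1 \<Longrightarrow> dist (X n) (X k) < 1"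
    using \<open>Cauchy X\<close> unfolding Cauchy_def by (metis zero_less_one)
  have "sqn (\<lambda>z. F N1 z - g z) \<le> ennreal (1\<^sup>2)"
    using N1 by (intro fatou[of N1]) (auto intro: less_imp_le)
  also have "\<dots> < \<infinity>" by simp
  finally have "(\<lambda>z. F N1 z - g z) \<in> F2"
    unfolding F2_iff by (intro conjI holomorphic_on_diff g F2_imp_holomorphic F)
  from F2_diff[OF F this, of N1] have gF: "g \<in> F2" by simp
  have "X \<longlonglongrightarrow> Abs_fock g"
  proof (rule metric_LIMSEQ_I)
    fix e :: real assume "e > 0"
    then obtain N where N: "\<And>n k. n \<ge> N \<Longrightarrow> k \<ge> N \<Longrightarrow> dist (X n) (X k) < e / 2"
      using \<open>Cauchy X\<close> unfolding Cauchy_def by (meson half_gt_zero)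
    have "dist (X n) (Abs_fock g) < e" if "n \<ge> N" for n
    proof -
      have "dist (X n) (Abs_fock g) = fock_norm (\<lambda>z. F n z - g z)"
        by (simp add: dist_norm norm_fock.rep_eq minus_fock.rep_eq Abs_fock_inverse gF F_def)
      also have "\<dots> \<le> e / 2"
        using N[OF \<open>n \<ge> N\<close>] \<open>e > 0\<close>
        by (intro fock_norm_leI F2_diff F gF fatou[of N]) (auto intro: less_imp_le)
      finally show ?thesis using \<open>e > 0\<close> by simp
    qed
    then show "\<exists>no. \<forall>n\<ge>no. dist (X n) (Abs_fock g) < e" by blast
  qed
  then show ?thesis by (rule convergentI)
qed

instance fock :: banach
  by standard (rule fock_Cauchy_convergent)

section \<open>Bounded operators and their spectra\<close>

lemma bounded_op_F2: "bounded_op T \<Longrightarrow> f \<in> F2 \<Longrightarrow> T f \<in> F2"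
  by (simp add: bounded_op_def)

lemma bounded_op_lincomb:
  "bounded_op T \<Longrightarrow> f \<in> F2 \<Longrightarrow> g \<in> F2 \<Longrightarrow> T (\<lambda>z. c * f z + d * g z) = (\<lambda>z. c * T f z + d * T g z)"
  by (simp add: bounded_op_def)

lemma bounded_op_cmult:
  "bounded_op T \<Longrightarrow> f \<in> F2 \<Longrightarrow> T (\<lambda>z. c * f z) = (\<lambda>z. c * T f z)"
  using bounded_op_lincomb[of T f f c 0] by simp

lemma bounded_op_add:
  "bounded_op T \<Longrightarrow> f \<in> F2 \<Longrightarrow> g \<in> F2 \<Longrightarrow> T (\<lambda>z. f z + g z) = (\<lambda>z. T f z + T g z)"
  using bounded_op_lincomb[of T f g 1 1] by simp

lemma bounded_op_bound:
  assumes "bounded_op T"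
  obtains C where "C \<ge> 0" "\<And>f. f \<in> F2 \<Longrightarrow> fock_norm (T f) \<le> C * fock_norm f"
proof -
  obtain C where C: "\<forall>f\<in>F2. fock_norm (T f) \<le> C * fock_norm f"
    using assms unfolding bounded_op_def by blast
  have "fock_norm (T f) \<le> \<bar>C\<bar> * fock_norm f" if "f \<in> F2" for f
    using C that by (meson abs_ge_self fock_norm_nonneg mult_right_mono order_trans)
  then show thesis using that[of "\<bar>C\<bar>"] by simp
qed

lemma fock_norm_le_op_norm:
  assumes T: "bounded_op T" and f: "f \<in> F2"
  shows "fock_norm (T f) \<le> op_norm T * fock_norm f"
proof -
  obtain C where "C \<ge> 0" and C: "\<And>f. f \<in> F2 \<Longrightarrow> fock_norm (T f) \<le> C * fock_norm f"
    using bounded_op_bound[OF T] by blast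
  show ?thesis
  proof (cases "fock_norm f = 0")
    case True
    then show ?thesis using C[OF f] by simp
  next
    case False
    let ?g = "\<lambda>z. of_real (1 / fock_norm f) * f z"
    have g: "?g \<in> F2" by (rule F2_cmult[OF f])
    have "fock_norm ?g = 1" using False by (subst fock_norm_cmult) (simp add: norm_divide)
    moreover have "bdd_above {fock_norm (T f) | f. f \<in> F2 \<and> fock_norm f \<le> 1}"
    proof (rule bdd_aboveI[of _ C])
      fix x assume "x \<in> {fock_norm (T f) | f. f \<in> F2 \<and> fock_norm f \<le> 1}"
      then obtain h where "h \<in> F2" "fock_norm h \<le> 1" "x = fock_norm (T h)" by blast
      then show "x \<le> C" using C[of h] \<open>C \<ge> 0\<close> mult_left_mono[of "fock_norm h" 1 C] by simp
    qed
    ultimately have "fock_norm (T ?g) \<le> op_norm T"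
      unfolding op_norm_def using g by (intro cSup_upper) auto
    also have "T ?g = (\<lambda>z. of_real (1 / fock_norm f) * T f z)"
      by (rule bounded_op_cmult[OF T f])
    finally show ?thesis
      using False by (simp only: fock_norm_cmult) (simp add: norm_divide field_simps less_le)
  qed
qed

lemma op_norm_le:
  assumes "0 \<le> r" and r: "\<And>f. f \<in> F2 \<Longrightarrow> fock_norm (T f) \<le> r * fock_norm f"
  shows "op_norm T \<le> r"
  unfolding op_norm_def
proof (rule cSup_least)
  have "fock_norm (\<lambda>z. 0) \<le> 1" using fock_norm_eq_0[OF F2_zero] by simp
  then show "{fock_norm (T f) | f. f \<in> F2 \<and> fock_norm f \<le> 1} \<noteq> {}" using F2_zero by blast
next
  fix x assume "x \<in> {fock_norm (T f) | f. f \<in> F2 \<and> fock_norm f \<le> 1}"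
  then obtain f where "f \<in> F2" "fock_norm f \<le> 1" "x = fock_norm (T f)" by blast
  then show "x \<le> r" using r[of f] \<open>0 \<le> r\<close> mult_left_mono[of "fock_norm f" 1 r] by simp
qed

definition fock_shift :: "((complex \<Rightarrow> complex) \<Rightarrow> (complex \<Rightarrow> complex)) \<Rightarrow> complex \<Rightarrow> fock \<Rightarrow> fock" where
  "fock_shift T l x = Abs_fock (shift_op T l (Rep_fock x))"

lemma shift_op_F2: "bounded_op T \<Longrightarrow> f \<in> F2 \<Longrightarrow> shift_op T l f \<in> F2"
  using F2_diff[of "T f" "\<lambda>z. l * f z"] by (simp add: shift_op_def F2_cmult bounded_op_F2)

lemma Rep_fock_shift:
  assumes "bounded_op T"
  shows "Rep_fock (fock_shift T l x) = shift_op T l (Rep_fock x)"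
  unfolding fock_shift_def by (intro Abs_fock_inverse shift_op_F2 assms Rep_fock)

lemma linear_fock_shift:
  assumes T: "bounded_op T"
  shows "linear (fock_shift T l)"
proof (rule linearI)
  fix x y :: fock and r :: real
  show "fock_shift T l (x + y) = fock_shift T l x + fock_shift T l y"
    by (simp add: Rep_fock_inject[symmetric] Rep_fock_shift T plus_fock.rep_eq shift_op_def
        bounded_op_add Rep_fock algebra_simps)
  show "fock_shift T l (r *\<^sub>R x) = r *\<^sub>R fock_shift T l x"
    by (simp add: Rep_fock_inject[symmetric] Rep_fock_shift T scaleR_fock.rep_eq shift_op_def
        bounded_op_cmult Rep_fock algebra_simps)
qed

lemma norm_fock_shift_diff:
  assumes T: "bounded_op T"
  shows "norm (fock_shift T l x - fock_shift T m x) = dist l m * norm x"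
proof -
  have "Rep_fock (fock_shift T l x - fock_shift T m x) = (\<lambda>z. (m - l) * Rep_fock x z)"
    by (simp add: minus_fock.rep_eq Rep_fock_shift T shift_op_def algebra_simps)
  then show ?thesis
    by (simp add: norm_fock.rep_eq fock_norm_cmult dist_norm norm_minus_commute)
qed

lemma bounded_linear_fock_shift:
  assumes T: "bounded_op T"
  shows "bounded_linear (fock_shift T l)"
proof -
  obtain C where C: "\<And>f. f \<in> F2 \<Longrightarrow> fock_norm (T f) \<le> C * fock_norm f"
    using bounded_op_bound[OF T] by blast
  have 0: "norm (fock_shift T 0 x) \<le> C * norm x" for x
    using C[OF Rep_fock[of x]] by (simp add: norm_fock.rep_eq Rep_fock_shift T shift_op_def)
  have "norm (fock_shift T l x) \<le> norm x * (C + cmod l)" for x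
    using norm_triangle_ineq[of "fock_shift T 0 x" "fock_shift T l x - fock_shift T 0 x"] 0[of x]
    by (simp add: norm_fock_shift_diff T algebra_simps)
  then show ?thesis
    by (intro bounded_linear_intro[where K = "C + cmod l"])
       (simp_all add: linear_fock_shift T linear_add linear_cmul)
qed

lemma bij_fock_shift_imp:
  assumes T: "bounded_op T" and "bij (fock_shift T l)"
  shows "bij_betw (shift_op T l) F2 F2"
proof (rule bij_betwI')
  fix f g assume "f \<in> F2" "g \<in> F2"
  then have "shift_op T l f = shift_op T l g \<longleftrightarrow> fock_shift T l (Abs_fock f) = fock_shift T l (Abs_fock g)"
    by (simp add: Rep_fock_inject[symmetric] Rep_fock_shift T Abs_fock_inverse)
  also have "\<dots> \<longleftrightarrow> Abs_fock f = Abs_fock g" using assms by (simp add: bij_is_inj inj_eq)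
  also have "\<dots> \<longleftrightarrow> f = g" using \<open>f \<in> F2\<close> \<open>g \<in> F2\<close> by (rule Abs_fock_inject)
  finally show "shift_op T l f = shift_op T l g \<longleftrightarrow> f = g" .
next
  fix g assume "g \<in> F2"
  obtain x where "fock_shift T l x = Abs_fock g" using assms by (metis bij_pointE)
  then have "g = shift_op T l (Rep_fock x)"
    using \<open>g \<in> F2\<close> by (metis Abs_fock_inverse Rep_fock_shift T)
  then show "\<exists>f\<in>F2. g = shift_op T l f" using Rep_fock by blast
qed (simp add: shift_op_F2 T)

lemma closed_range_fock_shift:
  assumes T: "bounded_op T" and "closed_in_F2 (shift_op T l ` F2)"
  shows "closed (range (fock_shift T l))"
  unfolding closed_sequential_limits
proof (intro allI impI, elim conjE)
  fix X x assume X: "\<forall>n. X n \<in> range (fock_shift T l)" and lim: "X \<longlonglongrightarrow> x"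
  have "Rep_fock (X n) \<in> shift_op T l ` F2" for n
    using X by (metis Rep_fock Rep_fock_shift T image_eqI rangeE)
  moreover have "(\<lambda>n. fock_norm (\<lambda>z. Rep_fock (X n) z - Rep_fock x z)) \<longlonglongrightarrow> 0"
    using lim[THEN LIM_zero, THEN tendsto_norm_zero] by (simp add: norm_fock.rep_eq minus_fock.rep_eq)
  ultimately have "Rep_fock x \<in> shift_op T l ` F2"
    using assms(2)[unfolded closed_in_F2_def, rule_format, of "\<lambda>n. Rep_fock (X n)" "Rep_fock x"] Rep_fock[of x]
    by simp
  then obtain f where "f \<in> F2" "Rep_fock x = shift_op T l f" by blast
  then have "x = fock_shift T l (Abs_fock f)"
    by (simp add: fock_shift_def Abs_fock_inverse) (metis Rep_fock_inverse)
  then show "x \<in> range (fock_shift T l)" by blast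
qed

lemma surj_fock_shift_large:
  assumes T: "bounded_op T"
  obtains l where "cmod l > r" "surj (fock_shift T l)"
proof -
  obtain C where "C \<ge> 0" and C: "\<And>f. f \<in> F2 \<Longrightarrow> fock_norm (T f) \<le> C * fock_norm f"
    using bounded_op_bound[OF T] by blast
  define l :: complex where "l = of_real (max r C + 1)"
  have l: "cmod l = max r C + 1" using \<open>C \<ge> 0\<close> by (simp add: l_def)
  define S where "S x = Abs_fock (\<lambda>z. - l * Rep_fock x z)" for x
  have RS: "Rep_fock (S x) = (\<lambda>z. - l * Rep_fock x z)" for x
    unfolding S_def by (intro Abs_fock_inverse F2_cmult Rep_fock)
  have "surj (fock_shift T l)"
  proof (rule surj_perturb)
    show "linear S"
      by (rule linearI)
         (simp_all add: Rep_fock_inject[symmetric] RS plus_fock.rep_eq scaleR_fock.rep_eq algebra_simps)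
    show "surj S"
    proof (rule surjI)
      fix x
      have "Rep_fock (Abs_fock (\<lambda>z. (- 1 / l) * Rep_fock x z)) = (\<lambda>z. (- 1 / l) * Rep_fock x z)"
        by (intro Abs_fock_inverse F2_cmult Rep_fock)
      moreover have "l \<noteq> 0" using l \<open>C \<ge> 0\<close> by auto
      ultimately show "S (Abs_fock (\<lambda>z. (- 1 / l) * Rep_fock x z)) = x"
        by (simp add: Rep_fock_inject[symmetric] RS)
    qed
    show "linear (fock_shift T l)" by (rule linear_fock_shift[OF T])
    show "cmod l * norm x \<le> norm (S x)" for x
      unfolding norm_fock.rep_eq RS fock_norm_cmult by simp
    show "norm (fock_shift T l x - S x) \<le> C * norm x" for x
      using C[OF Rep_fock[of x]]
      by (simp add: norm_fock.rep_eq minus_fock.rep_eq RS Rep_fock_shift T shift_op_def)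
  qed (use \<open>C \<ge> 0\<close> l in auto)
  then show thesis using that[of l] l by simp
qed

lemma fock_spectrum_bound:
  assumes T: "bounded_op T"
    and inj: "\<And>l. r < cmod l \<Longrightarrow> inj_on (shift_op T l) F2"
    and clo: "\<And>l. r < cmod l \<Longrightarrow> closed_in_F2 (shift_op T l ` F2)"
    and l: "l \<in> fock_spectrum T"
  shows "cmod l \<le> r"
proof (rule ccontr)
  assume "\<not> cmod l \<le> r"
  then have lr: "l \<in> - cball 0 r" by simp
  have inj': "inj (fock_shift T m)" if "r < cmod m" for m
    using inj[OF that]
    by (auto simp: inj_on_def Rep_fock_inject[symmetric] Rep_fock_shift T Rep_fock)
  obtain m where m: "cmod m > r" "surj (fock_shift T m)"
    using surj_fock_shift_large[OF T] by blast
  have "surj (fock_shift T l)"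
  proof (rule surj_on_connected[where \<Omega> = "- cball 0 r" and S = "fock_shift T" and m = m])
    show "connected (- cball (0::complex) r)"
      by (rule connected_complement_bounded_convex) auto
    show "linear (fock_shift T m)" for m by (rule linear_fock_shift[OF T])
    show "norm (fock_shift T m x - fock_shift T n x) \<le> dist m n * norm x" for m n x
      by (simp add: norm_fock_shift_diff T)
    show "\<exists>c>0. \<forall>x. c * norm x \<le> norm (fock_shift T m x)" if "m \<in> - cball 0 r" for m
      using that closed_range_inj_imp_bounded_below[OF bounded_linear_fock_shift[OF T] inj' closed_range_fock_shift[OF T clo]]
      by (metis ComplD dist_0_norm mem_cball not_le)
  qed (use m lr in auto)
  then have "bij (fock_shift T l)" using inj' lr by (simp add: bij_def)
  then show False using bij_fock_shift_imp[OF T] l by (simp add: fock_spectrum_def)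
qed

section \<open>Weighted composition operators\<close>

lemma weighted_eigenfunction_zero:
  fixes \<psi> d :: "complex \<Rightarrow> complex"
  assumes psi: "continuous_on UNIV \<psi>" and d: "continuous_on UNIV d" and a: "cmod a < 1"
    and l: "cmod (\<psi> p) < cmod l"
    and eig: "\<And>z. \<psi> z * d (a * (z - p) + p) = l * d z"
  shows "d z = 0"
proof -
  define q where "q = (cmod (\<psi> p) + cmod l) / 2"
  have q: "cmod (\<psi> p) < q" "q < cmod l" using l by (simp_all add: q_def)
  have l0: "l \<noteq> 0" using l by auto
  have "open {z. cmod (\<psi> z) < q}" by (intro open_Collect_less continuous_intros psi)
  then obtain \<delta> where "\<delta> > 0" and sub: "cball p \<delta> \<subseteq> {z. cmod (\<psi> z) < q}"
    using q open_contains_cball[of "{z. cmod (\<psi> z) < q}"] by blast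
  have stable: "a * (z - p) + p \<in> cball p \<delta>" if "z \<in> cball p \<delta>" for z
  proof -
    have "cmod (a * (z - p)) \<le> 1 * cmod (z - p)"
      unfolding norm_mult using a by (intro mult_right_mono) auto
    then show ?thesis using that by (simp add: dist_norm norm_minus_commute)
  qed
  have "\<exists>x\<in>cball p \<delta>. \<forall>y\<in>cball p \<delta>. cmod (d y) \<le> cmod (d x)"
    using \<open>\<delta> > 0\<close> by (intro continuous_attains_sup continuous_intros continuous_on_subset[OF d]) auto
  then obtain x where x: "x \<in> cball p \<delta>" and max: "\<And>y. y \<in> cball p \<delta> \<Longrightarrow> cmod (d y) \<le> cmod (d x)"
    by blast
  have "cmod l * cmod (d x) = cmod (\<psi> x) * cmod (d (a * (x - p) + p))"
    by (metis eig norm_mult)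
  also have "\<dots> \<le> q * cmod (d x)"
  proof (rule mult_mono)
    show "cmod (\<psi> x) \<le> q" using x sub by auto
    show "0 \<le> q" using q(1) norm_ge_zero[of "\<psi> p"] by linarith
    show "cmod (d (a * (x - p) + p)) \<le> cmod (d x)" by (rule max[OF stable[OF x]])
  qed simp
  finally have "cmod (d x) \<le> 0" using q by (simp add: mult_le_cancel_right)
  then have local: "d y = 0" if "y \<in> cball p \<delta>" for y using max[OF that] by simp
  have *: "cmod (a ^ n) * cmod (z - p) \<le> \<delta> \<Longrightarrow> d z = 0" for n z
  proof (induction n arbitrary: z)
    case 0
    then show ?case by (intro local) (simp add: dist_norm norm_minus_commute)
  next
    case (Suc n)
    then have "d (a * (z - p) + p) = 0" by (intro Suc.IH) (simp add: norm_mult mult_ac)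
    then show ?case using eig[of z] l0 by simp
  qed
  have "(\<lambda>n. cmod a ^ n * cmod (z - p)) \<longlonglongrightarrow> 0"
    using a by (intro tendsto_mult_left_zero LIMSEQ_power_zero) simp
  then have "\<forall>\<^sub>F n in sequentially. cmod a ^ n * cmod (z - p) < \<delta>"
    using \<open>\<delta> > 0\<close> by (rule order_tendstoD)
  then obtain n where "cmod a ^ n * cmod (z - p) < \<delta>" by (auto simp: eventually_sequentially)
  then show ?thesis by (intro *[of n]) (simp add: norm_power)
qed

lemma spectral_radius_wcomp:
  assumes psi: "\<psi> holomorphic_on UNIV" and a: "cmod a < 1" and p: "a * p + b = p"
    and T: "bounded_op (wcomp \<psi> (\<lambda>z. a * z + b))"
    and ess: "\<forall>l\<in>ess_spectrum (wcomp \<psi> (\<lambda>z. a * z + b)). cmod l \<le> cmod (\<psi> p)"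
  shows "spectral_radius (wcomp \<psi> (\<lambda>z. a * z + b)) = cmod (\<psi> p)"
proof -
  let ?T = "wcomp \<psi> (\<lambda>z. a * z + b)"
  have "\<psi> p \<in> fock_spectrum ?T"
  proof (rule ccontr)
    assume "\<psi> p \<notin> fock_spectrum ?T"
    then have "bij_betw (shift_op ?T (\<psi> p)) F2 F2" by (simp add: fock_spectrum_def)
    then obtain f where "shift_op ?T (\<psi> p) f = (\<lambda>z. 1)"
      using F2_const[of 1] by (metis bij_betw_imp_surj_on imageE)
    from fun_cong[OF this, of p] show False by (simp add: shift_op_def wcomp_def p)
  qed
  moreover have "cmod l \<le> cmod (\<psi> p)" if "l \<in> fock_spectrum ?T" for l
  proof (rule fock_spectrum_bound[OF T _ _ that])
    fix l assume l: "cmod (\<psi> p) < cmod l"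
    then have "fredholm (shift_op ?T l)" using ess by (force simp: ess_spectrum_def)
    then show "closed_in_F2 (shift_op ?T l ` F2)" by (simp add: fredholm_def)
    show "inj_on (shift_op ?T l) F2"
    proof (rule inj_onI, rule ext)
      fix f g z assume f: "f \<in> F2" and g: "g \<in> F2" and eq: "shift_op ?T l f = shift_op ?T l g"
      have b: "a * (z - p) + p = a * z + b" for z using p by (simp add: algebra_simps)
      have "f z - g z = 0"
      proof (rule weighted_eigenfunction_zero[where d = "\<lambda>z. f z - g z" and \<psi> = \<psi>, OF _ _ a l])
        show "continuous_on UNIV \<psi>" by (rule continuous_on_entire[OF psi])
        show "continuous_on UNIV (\<lambda>z. f z - g z)"
          by (intro continuous_intros continuous_on_entire F2_imp_holomorphic f g)
        show "\<psi> z * (f (a * (z - p) + p) - g (a * (z - p) + p)) = l * (f z - g z)" for z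
          using fun_cong[OF eq, of z] unfolding b shift_op_def wcomp_def by (simp add: algebra_simps)
      qed
      then show "f z = g z" by simp
    qed
  qed
  ultimately show ?thesis
    unfolding spectral_radius_def by (intro cSup_eq_maximum) auto
qed

lemma sqn_const: "sqn (\<lambda>z. c) = ennreal ((cmod c)\<^sup>2) * emeasure gaussian UNIV"
  by (simp add: sqn_def)

definition fock_kernel :: "complex \<Rightarrow> complex \<Rightarrow> complex" where
  "fock_kernel p z = exp (cnj p * z)"

lemma weyl_fock_kernel: "weyl p (fock_kernel p) = (\<lambda>z. exp (cnj p * p))"
  by (simp add: weyl_def fock_kernel_def fun_eq_iff algebra_simps flip: exp_add)

lemma holomorphic_fock_kernel: "fock_kernel p holomorphic_on UNIV"
  unfolding fock_kernel_def by (intro holomorphic_intros)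

lemma fock_kernel_F2: "fock_kernel p \<in> F2"
proof -
  have "ennreal (exp ((cmod p)\<^sup>2)) * sqn (fock_kernel p) = sqn (\<lambda>z. exp (cnj p * p))"
    by (simp add: sqn_weyl[symmetric] borel_measurable_entire holomorphic_fock_kernel weyl_fock_kernel)
  also have "\<dots> < \<infinity>" using F2_const by (simp add: F2_iff)
  finally show ?thesis
    by (auto simp: F2_iff holomorphic_fock_kernel ennreal_mult_less_top)
qed

lemma fock_kernel_nonzero: "fock_norm (fock_kernel p) > 0"
proof -
  have "fock_kernel p 0 \<noteq> 0" by (simp add: fock_kernel_def)
  then have "fock_norm (fock_kernel p) \<noteq> 0" using fock_norm_eq_0[OF fock_kernel_F2, of p] by metis
  then show ?thesis using fock_norm_nonneg[of "fock_kernel p"] by linarith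
qed

text \<open>Equality in the mean value inequality: \<open>weyl p (fock_kernel p)\<close> is constant,
  so a function whose norm is not larger than its value at \<open>0\<close> permits is constant as well.\<close>

lemma eq_fock_kernel_of_norm_le:
  assumes g: "g \<in> F2" and le: "fock_norm g \<le> cmod c * fock_norm (fock_kernel p)"
    and gp: "g p = c * fock_kernel p p"
  shows "g z = c * fock_kernel p z"
proof -
  let ?E = "ennreal (exp ((cmod p)\<^sup>2))"
  have hg: "weyl p g holomorphic_on UNIV" by (intro holomorphic_weyl F2_imp_holomorphic g)
  have "sqn (weyl p g) = ?E * ennreal ((fock_norm g)\<^sup>2)"
    by (simp add: sqn_weyl borel_measurable_entire F2_imp_holomorphic F2_imp_sqn g)
  also have "\<dots> \<le> ?E * ennreal ((cmod c * fock_norm (fock_kernel p))\<^sup>2)"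
    by (intro mult_left_mono ennreal_leI power_mono le) auto
  also have "\<dots> = ennreal ((cmod c)\<^sup>2) * (?E * sqn (fock_kernel p))"
    by (simp add: F2_imp_sqn fock_kernel_F2 power_mult_distrib ennreal_mult mult_ac)
  also have "?E * sqn (fock_kernel p) = sqn (\<lambda>z. fock_kernel p p)"
    by (simp add: sqn_weyl[symmetric] borel_measurable_entire holomorphic_fock_kernel weyl_fock_kernel)
       (simp add: fock_kernel_def)
  also have "ennreal ((cmod c)\<^sup>2) * \<dots> = ennreal ((cmod (weyl p g 0))\<^sup>2) * emeasure gaussian UNIV"
    by (simp add: sqn_const gp norm_mult power_mult_distrib ennreal_mult mult.assoc)
  finally have "ennreal ((cmod (weyl p g 0))\<^sup>2) * emeasure gaussian UNIV + sqn (\<lambda>z. weyl p g z - weyl p g 0)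
      \<le> ennreal ((cmod (weyl p g 0))\<^sup>2) * emeasure gaussian UNIV + 0"
    by (simp add: sqn_pythagoras[OF hg])
  then have 0: "sqn (\<lambda>z. weyl p g z - weyl p g 0) = 0"
    using emeasure_gaussian_finite
    by (subst (asm) ennreal_add_left_cancel_le) (auto simp: ennreal_mult_eq_top_iff)
  then have F: "(\<lambda>z. weyl p g z - weyl p g 0) \<in> F2"
    using hg by (auto simp: F2_iff intro!: holomorphic_on_diff)
  have "fock_norm (\<lambda>z. weyl p g z - weyl p g 0) = 0"
    using 0 F2_imp_sqn[OF F] by simp
  then have "weyl p g w = weyl p g 0" for w
    using fock_norm_eq_0[OF F] by (auto dest: fun_cong)
  from this[of "z - p"] have eq: "exp (- (cnj p * (z - p))) * g z = c * exp (cnj p * p)"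
    by (simp add: weyl_def gp fock_kernel_def)
  have "g z = exp (cnj p * (z - p)) * exp (- (cnj p * (z - p))) * g z"
    by (simp only: exp_minus_inverse mult_1)
  also have "\<dots> = c * exp (cnj p * (z - p) + cnj p * p)"
    by (simp only: mult.assoc eq exp_add mult.left_commute)
  also have "cnj p * (z - p) + cnj p * p = cnj p * z" by (simp add: algebra_simps)
  finally show ?thesis by (simp add: fock_kernel_def)
qed

lemma op_norm_wcomp_eq_imp:
  assumes T: "bounded_op (wcomp \<psi> (\<lambda>z. a * z + b))" and p: "a * p + b = p"
    and norm: "op_norm (wcomp \<psi> (\<lambda>z. a * z + b)) = cmod (\<psi> p)"
  shows "\<psi> z = \<psi> p * exp (cnj p * (1 - a) * (z - p))"
proof -
  have b: "b = p - a * p" using p by (simp add: algebra_simps)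
  let ?g = "wcomp \<psi> (\<lambda>z. a * z + b) (fock_kernel p)"
  have "?g z = \<psi> p * fock_kernel p z"
  proof (rule eq_fock_kernel_of_norm_le)
    show "?g \<in> F2" by (rule bounded_op_F2[OF T fock_kernel_F2])
    show "fock_norm ?g \<le> cmod (\<psi> p) * fock_norm (fock_kernel p)"
      using fock_norm_le_op_norm[OF T fock_kernel_F2] by (simp add: norm)
    show "?g p = \<psi> p * fock_kernel p p" by (simp add: wcomp_def p)
  qed
  then have "\<psi> z = \<psi> p * exp (cnj p * z) / exp (cnj p * (a * z + b))"
    by (simp add: wcomp_def fock_kernel_def field_simps)
  also have "\<dots> = \<psi> p * exp (cnj p * z - cnj p * (a * z + b))" by (simp add: exp_diff)
  also have "cnj p * z - cnj p * (a * z + b) = cnj p * (1 - a) * (z - p)"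
    unfolding b by (simp add: algebra_simps)
  finally show ?thesis .
qed

lemma op_norm_wcomp_eq:
  assumes T: "bounded_op (wcomp \<psi> (\<lambda>z. a * z + b))" and p: "a * p + b = p" and a: "cmod a < 1"
    and psi: "\<And>z. \<psi> z = \<psi> p * exp (cnj p * (1 - a) * (z - p))"
  shows "op_norm (wcomp \<psi> (\<lambda>z. a * z + b)) = cmod (\<psi> p)"
proof (rule antisym)
  let ?T = "wcomp \<psi> (\<lambda>z. a * z + b)"
  have b: "b = p - a * p" using p by (simp add: algebra_simps)
  show "op_norm ?T \<le> cmod (\<psi> p)"
  proof (rule op_norm_le)
    fix f assume f: "f \<in> F2"
    have hw: "weyl p f holomorphic_on UNIV" by (intro holomorphic_weyl F2_imp_holomorphic f)
    have "weyl p (?T f) z = \<psi> p * weyl p f (a * z)" for z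
    proof -
      have "exp (- cnj p * z) * \<psi> (z + p) = \<psi> p * exp (- cnj p * (a * z))"
        by (subst psi) (simp add: algebra_simps flip: exp_add)
      then show ?thesis by (simp add: weyl_def wcomp_def b algebra_simps)
    qed
    then have w: "weyl p (?T f) = (\<lambda>z. \<psi> p * weyl p f (a * z))" by blast
    have "(\<lambda>z. weyl p f (a * z)) holomorphic_on UNIV"
      by (rule holomorphic_on_compose_gen[OF _ hw, unfolded o_def]) (auto intro: holomorphic_intros)
    then have "sqn (weyl p (?T f)) = ennreal ((cmod (\<psi> p))\<^sup>2) * sqn (\<lambda>z. weyl p f (a * z))"
      unfolding w by (intro sqn_cmult borel_measurable_entire)
    also have "\<dots> \<le> ennreal ((cmod (\<psi> p))\<^sup>2) * sqn (weyl p f)"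
      by (intro mult_left_mono sqn_dilate_le hw a) auto
    finally have "sqn (weyl p (?T f)) \<le> ennreal ((cmod (\<psi> p))\<^sup>2) * sqn (weyl p f)" .
    moreover have "sqn (weyl p g) = ennreal (exp ((cmod p)\<^sup>2) * (fock_norm g)\<^sup>2)" if "g \<in> F2" for g
      using that by (simp add: sqn_weyl borel_measurable_entire F2_imp_holomorphic F2_imp_sqn ennreal_mult)
    ultimately have "ennreal (exp ((cmod p)\<^sup>2) * (fock_norm (?T f))\<^sup>2)
        \<le> ennreal (exp ((cmod p)\<^sup>2) * ((cmod (\<psi> p))\<^sup>2 * (fock_norm f)\<^sup>2))"
      using f bounded_op_F2[OF T f] by (simp add: ennreal_mult mult.left_commute)
    then have "(fock_norm (?T f))\<^sup>2 \<le> (cmod (\<psi> p) * fock_norm f)\<^sup>2"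
      by (simp add: power_mult_distrib)
    then show "fock_norm (?T f) \<le> cmod (\<psi> p) * fock_norm f"
      by (rule power2_le_imp_le) simp
  qed simp
  have "?T (fock_kernel p) = (\<lambda>z. \<psi> p * fock_kernel p z)"
  proof
    fix z
    have "?T (fock_kernel p) z = \<psi> p * exp (cnj p * (1 - a) * (z - p)) * exp (cnj p * (a * z + b))"
      unfolding wcomp_def fock_kernel_def by (subst psi) simp
    also have "\<dots> = \<psi> p * exp (cnj p * (1 - a) * (z - p) + cnj p * (a * z + b))"
      by (simp add: exp_add)
    also have "cnj p * (1 - a) * (z - p) + cnj p * (a * z + b) = cnj p * z"
      by (simp add: b algebra_simps)
    finally show "?T (fock_kernel p) z = \<psi> p * fock_kernel p z" unfolding fock_kernel_def .
  qed
  then have "cmod (\<psi> p) * fock_norm (fock_kernel p) \<le> op_norm ?T * fock_norm (fock_kernel p)"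
    using fock_norm_le_op_norm[OF T fock_kernel_F2, of p] by (simp add: fock_norm_cmult)
  then show "cmod (\<psi> p) \<le> op_norm ?T"
    using fock_kernel_nonzero by (simp add: mult_le_cancel_right_pos)
qed

theorem theorem2p4:
  fixes \<psi> :: "complex \<Rightarrow> complex" and a b :: complex
  assumes "\<psi> holomorphic_on UNIV"
    and "\<exists>z. \<psi> z \<noteq> 0"
    and "cmod a < 1"
    and "bounded_op (wcomp \<psi> (\<lambda>z. a * z + b))"
    and "\<forall>l\<in>ess_spectrum (wcomp \<psi> (\<lambda>z. a * z + b)). cmod l \<le> cmod (\<psi> (b / (1 - a)))"
  shows "normaloid (wcomp \<psi> (\<lambda>z. a * z + b)) \<longleftrightarrow>
         (\<forall>z. \<psi> z = \<psi> 0 * exp (cnj b * (a - 1) / (cnj a - 1) * z))"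
proof -
  define p where "p = b / (1 - a)"
  define k where "k = cnj p * (1 - a)"
  have "a \<noteq> 1" using assms(3) by auto
  then have "1 - a \<noteq> 0" "cnj a - 1 \<noteq> 0" by (auto simp: complex_eq_iff)
  then have p: "a * p + b = p" and k: "cnj b * (a - 1) / (cnj a - 1) = k"
    by (simp_all add: p_def k_def field_simps)
  have "normaloid (wcomp \<psi> (\<lambda>z. a * z + b)) \<longleftrightarrow> op_norm (wcomp \<psi> (\<lambda>z. a * z + b)) = cmod (\<psi> p)"
    using spectral_radius_wcomp[OF assms(1,3) p assms(4)] assms(5) by (simp add: normaloid_def p_def)
  also have "\<dots> \<longleftrightarrow> (\<forall>z. \<psi> z = \<psi> p * exp (k * (z - p)))"
    unfolding k_def using op_norm_wcomp_eq_imp[OF assms(4) p] op_norm_wcomp_eq[OF assms(4) p assms(3)] by blast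
  also have "\<dots> \<longleftrightarrow> (\<forall>z. \<psi> z = \<psi> 0 * exp (k * z))"
  proof
    assume *: "\<forall>z. \<psi> z = \<psi> p * exp (k * (z - p))"
    show "\<forall>z. \<psi> z = \<psi> 0 * exp (k * z)"
    proof
      fix z
      have "\<psi> z = \<psi> p * exp (k * (z - p))" using * by blast
      also have "k * (z - p) = k * (0 - p) + k * z" by (simp add: algebra_simps)
      also have "\<psi> p * exp \<dots> = \<psi> p * exp (k * (0 - p)) * exp (k * z)"
        by (simp only: exp_add mult.assoc)
      also have "\<psi> p * exp (k * (0 - p)) = \<psi> 0" by (rule spec[OF *, of 0, symmetric])
      finally show "\<psi> z = \<psi> 0 * exp (k * z)" .
    qed
  next
    assume *: "\<forall>z. \<psi> z = \<psi> 0 * exp (k * z)"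
    show "\<forall>z. \<psi> z = \<psi> p * exp (k * (z - p))"
    proof
      fix z
      have "\<psi> z = \<psi> 0 * exp (k * z)" using * by blast
      also have "k * z = k * p + k * (z - p)" by (simp add: algebra_simps)
      also have "\<psi> 0 * exp \<dots> = \<psi> 0 * exp (k * p) * exp (k * (z - p))"
        by (simp only: exp_add mult.assoc)
      also have "\<psi> 0 * exp (k * p) = \<psi> p" by (rule spec[OF *, of p, symmetric])
      finally show "\<psi> z = \<psi> p * exp (k * (z - p))" .
    qed
  qed
  finally show ?thesis unfolding k .
qed

end
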